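(* Let $a,b>0$ and let $\Omega_{a,b}=[0,a]\times[0,b]\subset\mathbb{R}^2$. The rectangle $\Omega_{a,b}$ satisfies property (M) if and only if $(a/b)^2$ is rational.
   Context: A planar domain is said to satisfy property (M) if the set of multiplicities of the eigenvalues of the Laplace operator on it with Dirichlet boundary condition (i.e. $-\Delta V=\lambda V$ in the domain, $V=0$ on the boundary) is exactly $\mathbb{N}=\{1,2,3,\dots\}$. The multiplicity of an eigenvalue is the dimension of its eigenspace. *)

theory Defs
  imports "HOL-Analysis.Analysis" "HOL-Library.Function_Algebras"
begin

definition partial_x :: "(real \<times> real \<Rightarrow> real) \<Rightarrow> real \<times> real \<Rightarrow> real" where
  "partial_x u = (\<lambda>(x, y). deriv (\<lambda>s. u (s, y)) x)"

definition partial_y :: "(real \<times> real \<Rightarrow> real) \<Rightarrow> real \<times> real \<Rightarrow> real" where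
  "partial_y u = (\<lambda>(x, y). deriv (\<lambda>t. u (x, t)) y)"

text \<open>\<^const>\<open>deriv\<close> is an unspecified value where the derivative does not exist, so the
  existence of the partial derivatives is required separately. Both predicates below are meant for
  open sets.\<close>

definition C1_on :: "(real \<times> real) set \<Rightarrow> (real \<times> real \<Rightarrow> real) \<Rightarrow> bool" where
  "C1_on U u \<longleftrightarrow>
     (\<forall>(x, y) \<in> U. (\<lambda>s. u (s, y)) differentiable at x \<and> (\<lambda>t. u (x, t)) differentiable at y) \<and>
     continuous_on U (partial_x u) \<and> continuous_on U (partial_y u)"

definition C2_on :: "(real \<times> real) set \<Rightarrow> (real \<times> real \<Rightarrow> real) \<Rightarrow> bool" where
  "C2_on U u \<longleftrightarrow> C1_on U u \<and> C1_on U (partial_x u) \<and> C1_on U (partial_y u)"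

definition laplacian :: "(real \<times> real \<Rightarrow> real) \<Rightarrow> real \<times> real \<Rightarrow> real" where
  "laplacian u p = partial_x (partial_x u) p + partial_y (partial_y u) p"

text \<open>Classical Dirichlet eigenfunctions, together with the zero function. A function on the closure
  of the domain is represented by its extension by zero to the whole plane, so that distinct
  elements of the eigenspace differ on the domain.\<close>

definition dirichlet_eigenspace :: "(real \<times> real) set \<Rightarrow> real \<Rightarrow> (real \<times> real \<Rightarrow> real) set" where
  "dirichlet_eigenspace \<Omega> \<mu> =
     {V. continuous_on (closure \<Omega>) V \<and> C2_on (interior \<Omega>) V \<and>
         (\<forall>p \<in> interior \<Omega>. - laplacian V p = \<mu> * V p) \<and>
         (\<forall>p \<in> frontier \<Omega>. V p = 0) \<and>
         (\<forall>p. p \<notin> closure \<Omega> \<longrightarrow> V p = 0)}"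

definition dirichlet_eigenvalue :: "(real \<times> real) set \<Rightarrow> real \<Rightarrow> bool" where
  "dirichlet_eigenvalue \<Omega> \<mu> \<longleftrightarrow> (\<exists>V \<in> dirichlet_eigenspace \<Omega> \<mu>. \<exists>p. V p \<noteq> 0)"

definition fun_scale :: "real \<Rightarrow> ('a \<Rightarrow> real) \<Rightarrow> 'a \<Rightarrow> real" where
  "fun_scale c f = (\<lambda>x. c * f x)"

lemma vector_space_fun_scale: "vector_space fun_scale"
  by unfold_locales (simp_all add: fun_scale_def fun_eq_iff algebra_simps)

text \<open>The dimension is 0 for infinite-dimensional spaces; since 0 is not a positive integer, an
  eigenvalue of infinite multiplicity would violate property (M), as it should.\<close>

definition eigenvalue_multiplicity :: "(real \<times> real) set \<Rightarrow> real \<Rightarrow> nat" where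
  "eigenvalue_multiplicity \<Omega> \<mu> = vector_space.dim fun_scale (dirichlet_eigenspace \<Omega> \<mu>)"

definition property_M :: "(real \<times> real) set \<Rightarrow> bool" where
  "property_M \<Omega> \<longleftrightarrow> {eigenvalue_multiplicity \<Omega> \<mu> | \<mu>. dirichlet_eigenvalue \<Omega> \<mu>} = {1..}"

end

theory Submission
  imports Defs "HOL-Number_Theory.Cong"
begin

text \<open>The functions \<open>sin (m \<pi> x / a) sin (n \<pi> y / b)\<close> form a complete orthogonal system, and
  Green's identity shows that an eigenfunction for \<open>\<mu>\<close> is orthogonal to all of them except those
  with \<open>(m \<pi> / a)\<^sup>2 + (n \<pi> / b)\<^sup>2 = \<mu>\<close>. So the multiplicity of \<open>\<mu>\<close> is the number of such pairs
  \<open>(m, n)\<close> of positive integers. It is at most 1 if \<open>(a / b)\<^sup>2\<close> is irrational; if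
  \<open>(a / b)\<^sup>2 = p / q\<close>, it is the number of positive solutions of \<open>q m\<^sup>2 + p n\<^sup>2 = N\<close> for a rescaled
  \<open>N\<close>.

  For \<open>q < p\<close> and a suitable prime \<open>l\<close>, let \<open>f j\<close> be the number of positive solutions of
  \<open>q m\<^sup>2 + p n\<^sup>2 = q l\<^bsup>2j\<^esup>\<close>. Multiplication by \<open>l\<close> embeds the solutions for \<open>j\<close> into those for
  \<open>j + 1\<close>, and at most one solution is not in the image, namely a primitive one. Hence \<open>f\<close> starts
  at 0 and grows by steps of at most 1. It is unbounded since the pigeonhole principle (finiteness
  of the class number in disguise) yields primitive solutions of \<open>X\<^sup>2 + p q Y\<^sup>2 = l\<^bsup>2t\<^esup>\<close> for
  arbitrarily large \<open>t\<close>. So \<open>f\<close> attains every value. The case \<open>p = q\<close> of sums of two squares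
  reduces to the form \<open>m\<^sup>2 + 4 n\<^sup>2\<close>.\<close>

section \<open>Representation numbers of diagonal binary forms\<close>

text \<open>Euclid's argument: no prime up to \<open>D + 1\<close> divides \<open>D w^2 + 1\<close>
  when \<open>w\<close> is the factorial of \<open>D + 1\<close>, and multiplying this number by
  \<open>D\<close> gives \<open>(D w)^2 + D\<close>. The size of \<open>l\<close> makes it odd and
  prevents it from dividing \<open>D\<close> or any positive multiplier \<open>c \<le> D\<close> met
  later.\<close>

lemma exists_large_prime_dvd_square_plus:
  fixes D :: int
  assumes "D > 0"
  obtains l r where "prime l" "l > D + 1" "l dvd r\<^sup>2 + D"
proof -
  define w :: int where "w = fact (nat (D + 1))"
  have w: "w > 0" by (simp add: w_def)
  have "D * w\<^sup>2 + 1 > 1" using assms w by simp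
  then obtain l where l: "prime l" "l dvd D * w\<^sup>2 + 1"
    by (metis abs_of_pos less_irrefl prime_factor_int zero_less_one order_less_trans)
  have "l > D + 1"
  proof (rule ccontr)
    assume "\<not> l > D + 1"
    moreover have "l > 0" using l by (simp add: prime_gt_0_int)
    ultimately have "nat l dvd fact (nat (D + 1))"
      by (intro dvd_fact) auto
    then have "int (nat l) dvd int (fact (nat (D + 1)))"
      by (simp only: int_dvd_int_iff)
    then have "l dvd w" using \<open>l > 0\<close> by (simp add: w_def)
    then have "l dvd D * w\<^sup>2" by (simp add: power2_eq_square)
    with l(2) have "l dvd 1" using dvd_add_right_iff by blast
    with l(1) show False by auto
  qed
  moreover have "l dvd (D * w)\<^sup>2 + D"
  proof -
    have "(D * w)\<^sup>2 + D = D * (D * w\<^sup>2 + 1)" by (simp add: power2_eq_square algebra_simps)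
    with l(2) show ?thesis by simp
  qed
  ultimately show thesis using l(1) that by blast
qed

text \<open>Hensel lifting: \<open>2 r\<close> is a unit modulo \<open>l\<close>, so a root modulo
  one power of \<open>l\<close> can be corrected to a root modulo the next.\<close>

lemma sqrt_mod_prime_power:
  fixes l D r :: int
  assumes l: "prime l" "odd l" "\<not> l dvd D" and r: "l dvd r\<^sup>2 + D"
  shows "\<exists>r. l ^ s dvd r\<^sup>2 + D"
proof (cases s)
  case (Suc j)
  have "\<exists>r. l ^ Suc j dvd r\<^sup>2 + D"
  proof (induction j)
    case 0
    then show ?case using r by auto
  next
    case (Suc j)
    then obtain r k where r: "r\<^sup>2 + D = l ^ Suc j * k" by (auto elim!: dvdE)
    have "\<not> l dvd r"
    proof
      assume "l dvd r"
      moreover have "l dvd r\<^sup>2 + D" using r by simp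
      ultimately show False using l(3) by (simp add: power2_eq_square dvd_add_right_iff)
    qed
    moreover have "\<not> l dvd 2"
      using l by (metis dvd_refl primes_dvd_imp_eq two_is_prime)
    ultimately have "\<not> l dvd 2 * r" using l(1) prime_dvd_multD by blast
    then have "coprime l (2 * r)" using l(1) prime_imp_coprime by blast
    then obtain u where "[2 * r * u = 1] (mod l)"
      using cong_solve_coprime_int coprime_commute by blast
    then have "l dvd 2 * r * u - 1" by (simp add: cong_iff_dvd_diff)
    then obtain v where v: "2 * r * u = 1 + l * v" unfolding dvd_def by (metis add.commute diff_add_cancel)
    \<comment> \<open>Newton's step: since \<open>u\<close> inverts \<open>2 r\<close> modulo
      \<open>l\<close>, the linear term cancels the error \<open>k l^(j+1)\<close> up to one more
      factor \<open>l\<close>.\<close>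
    have "(r - k * u * l ^ Suc j)\<^sup>2 + D = (r\<^sup>2 + D) - k * l ^ Suc j * (2 * r * u) + k\<^sup>2 * u\<^sup>2 * (l ^ Suc j * l ^ Suc j)"
      by (simp add: power2_eq_square algebra_simps)
    also have "\<dots> = l ^ Suc (Suc j) * (- k * v + k\<^sup>2 * u\<^sup>2 * l ^ j)"
      unfolding v r by (simp add: algebra_simps)
    finally show ?case by (metis dvd_triv_left)
  qed
  then show ?thesis using Suc by simp
qed simp

text \<open>Thue's argument: the lattice \<open>x = r y\<close> modulo \<open>L^2\<close>, where
  \<open>L = l^i\<close>, contains a vector with \<open>\<bar>x\<bar> < L\<close> and
  \<open>0 < y \<le> L\<close>. Its value under \<open>x^2 + D y^2\<close> is a multiple of
  \<open>L^2\<close> below \<open>(D + 1) L^2\<close>. A common factor \<open>l\<close> of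
  \<open>x\<close> and \<open>y\<close> would force \<open>l\<close> to divide \<open>c\<close>, but
  \<open>c < l\<close>.\<close>

lemma thue_primitive_multiple:
  fixes l D r :: int
  assumes l: "prime l" "l > D + 1" and D: "D > 0" and i: "i > 0" and r: "l ^ (2 * i) dvd r\<^sup>2 + D"
  obtains x y c where "x\<^sup>2 + D * y\<^sup>2 = c * l ^ (2 * i)" "0 < c" "c \<le> D"
    "l ^ (2 * i) dvd x - r * y" "\<not> (l dvd x \<and> l dvd y)"
proof -
  define L where "L = l ^ i"
  have l0: "l > 0" using l D by simp
  have L: "L > 0" "l ^ (2 * i) = L\<^sup>2"
    using l0 by (simp_all add: L_def power_mult[symmetric] mult.commute)
  \<comment> \<open>Approximating \<open>r / L^2\<close> by a fraction with denominator
    \<open>k \<le> L\<close> leaves an error below \<open>1 / L\<close>; multiplication by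
    \<open>L^2\<close> turns this into \<open>\<bar>k r - h L^2\<bar> < L\<close>.\<close>
  obtain h k where hk: "0 < k" "k \<le> int (nat L)"
      "\<bar>of_int k * (of_int r / of_int (L\<^sup>2)) - of_int h\<bar> < 1 / real (nat L)"
  proof (rule Dirichlet_approx)
    show "nat L > 0" using L by simp
  qed
  define x where "x = k * r - h * L\<^sup>2"
  have "\<bar>real_of_int x\<bar> = of_int (L\<^sup>2) * \<bar>of_int k * (of_int r / of_int (L\<^sup>2)) - of_int h\<bar>"
    using L by (simp add: x_def abs_mult[symmetric] field_simps flip: abs_mult)
  also have "\<dots> < of_int (L\<^sup>2) * (1 / real (nat L))"
    using hk(3) L by (intro mult_strict_left_mono) auto
  also have "\<dots> = of_int L" using L by (simp add: power2_eq_square)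
  finally have "\<bar>x\<bar> < L" by linarith
  then have x2: "x\<^sup>2 < L\<^sup>2" using power_strict_mono[of "\<bar>x\<bar>" L 2] by simp
  have k2: "k\<^sup>2 \<le> L\<^sup>2" using hk L by (intro power_mono) auto
  have dvd: "l ^ (2 * i) dvd x - r * k" unfolding L(2) x_def by (simp add: algebra_simps)
  have "x\<^sup>2 + D * k\<^sup>2 = (x - r * k) * (x + r * k) + (r\<^sup>2 + D) * k\<^sup>2" by (simp add: power2_eq_square algebra_simps)
  then have "L\<^sup>2 dvd x\<^sup>2 + D * k\<^sup>2" using dvd r L(2) by simp
  then obtain c where c: "x\<^sup>2 + D * k\<^sup>2 = c * L\<^sup>2" by (metis dvdE mult.commute)
  have "x\<^sup>2 + D * k\<^sup>2 > 0" using D hk(1) by (simp add: add_nonneg_pos)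
  then have c0: "c > 0" using c L by (simp add: zero_less_mult_iff)
  have "c * L\<^sup>2 < (D + 1) * L\<^sup>2"
    using x2 mult_left_mono[OF k2, of D] D c unfolding distrib_right by linarith
  then have cD: "c \<le> D" using L(1) by simp
  have "\<not> (l dvd x \<and> l dvd k)"
  proof
    assume "l dvd x \<and> l dvd k"
    then obtain x' k' where x': "x = l * x'" "k = l * k'" by (auto elim!: dvdE)
    obtain j where j: "2 * i = Suc j" using i by (cases "2 * i") auto
    \<comment> \<open>Dividing the vector by \<open>l\<close> costs the congruence one factor
      \<open>l\<close> but the form two, and this surplus ends up in \<open>c\<close>.\<close>
    have "l * l ^ j dvd l * (x' - r * k')" using dvd j x' by (simp add: algebra_simps)
    then have d: "l ^ j dvd x' - r * k'" using l0 by simp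
    have "x'\<^sup>2 + D * k'\<^sup>2 = (x' - r * k') * (x' + r * k') + (r\<^sup>2 + D) * k'\<^sup>2" by (simp add: power2_eq_square algebra_simps)
    moreover have "l ^ j dvd r\<^sup>2 + D" using r j by (metis dvd_trans dvd_triv_right power_Suc)
    ultimately have "l ^ j dvd x'\<^sup>2 + D * k'\<^sup>2" using d by simp
    then have "l\<^sup>2 * l ^ j dvd l\<^sup>2 * (x'\<^sup>2 + D * k'\<^sup>2)" by simp
    also have "\<dots> = c * l ^ Suc j"
      using c x' L(2) j by (simp add: power2_eq_square algebra_simps)
    finally have "l dvd c" using l0 by (simp add: power2_eq_square mult.assoc)
    then show False using zdvd_not_zless[of c l] c0 cD l by simp
  qed
  with c c0 cD dvd L that show thesis by metis
qed

lemma prime_dvd_binary_form_iff: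
  fixes l p q x y :: int
  assumes l: "prime l" "\<not> l dvd p" "\<not> l dvd q" and dvd: "l dvd q * x\<^sup>2 + p * y\<^sup>2"
  shows "l dvd x \<longleftrightarrow> l dvd y"
proof -
  have "l dvd q * x\<^sup>2 \<longleftrightarrow> l dvd p * y\<^sup>2"
    using dvd dvd_add_right_iff dvd_add_left_iff by blast
  then show ?thesis using l by (simp add: prime_dvd_mult_iff prime_dvd_power_iff)
qed

text \<open>Write \<open>w\<close> for a square root of \<open>-D\<close>. Thue's argument gives
  elements \<open>x + y w\<close> of norm \<open>c l^(2 T k)\<close> with \<open>c \<le> D\<close>
  for more than \<open>D^3\<close> values of \<open>k\<close>. Two of them agree in \<open>c\<close>
  and in their residues modulo \<open>c\<close>; their quotient is integral, has norm
  \<open>l^(2t)\<close> with \<open>t = T (k2 - k1)\<close>, and inherits primitivity from the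
  larger element.\<close>

lemma primitive_norm_prime_power:
  fixes l D :: int
  assumes l: "prime l" "l > D + 1" and D: "D > 0" and roots: "\<And>s. \<exists>r. l ^ s dvd r\<^sup>2 + D"
    and T: "T > 0"
  obtains t X Y where "t \<ge> T" "X\<^sup>2 + D * Y\<^sup>2 = l ^ (2 * t)" "\<not> l dvd X" "\<not> l dvd Y"
proof -
  define K where "K = {1..Suc (nat (D * D * D))}"
  obtain r where r: "l ^ (2 * (T * Suc (nat (D * D * D)))) dvd r\<^sup>2 + D" using roots by blast
  have l0: "l > 0" using l D by simp
  have "\<forall>k\<in>K. \<exists>x y c. x\<^sup>2 + D * y\<^sup>2 = c * l ^ (2 * (T * k)) \<and> 0 < c \<and> c \<le> D \<and>
      l ^ (2 * (T * k)) dvd x - r * y \<and> \<not> (l dvd x \<and> l dvd y)"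
  proof
    fix k assume k: "k \<in> K"
    have "l ^ (2 * (T * k)) dvd l ^ (2 * (T * Suc (nat (D * D * D))))"
      using k unfolding K_def by (intro le_imp_power_dvd mult_le_mono2) auto
    then have "l ^ (2 * (T * k)) dvd r\<^sup>2 + D" using r dvd_trans by blast
    moreover have "T * k > 0" using k T by (auto simp: K_def)
    ultimately obtain x y c where "x\<^sup>2 + D * y\<^sup>2 = c * l ^ (2 * (T * k))" "0 < c" "c \<le> D"
      "l ^ (2 * (T * k)) dvd x - r * y" "\<not> (l dvd x \<and> l dvd y)"
      using thue_primitive_multiple[OF l D] by metis
    then show "\<exists>x y c. x\<^sup>2 + D * y\<^sup>2 = c * l ^ (2 * (T * k)) \<and> 0 < c \<and> c \<le> D \<and>
      l ^ (2 * (T * k)) dvd x - r * y \<and> \<not> (l dvd x \<and> l dvd y)" by blast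
  qed
  then obtain x y c where g: "\<And>k. k \<in> K \<Longrightarrow> (x k)\<^sup>2 + D * (y k)\<^sup>2 = c k * l ^ (2 * (T * k))"
    "\<And>k. k \<in> K \<Longrightarrow> 0 < c k" "\<And>k. k \<in> K \<Longrightarrow> c k \<le> D"
    "\<And>k. k \<in> K \<Longrightarrow> l ^ (2 * (T * k)) dvd x k - r * y k"
    "\<And>k. k \<in> K \<Longrightarrow> \<not> (l dvd x k \<and> l dvd y k)"
    by metis
  define cls where "cls k = (c k, x k mod c k, y k mod c k)" for k
  have "cls ` K \<subseteq> {1..D} \<times> {0..<D} \<times> {0..<D}"
  proof (rule image_subsetI)
    fix k assume k: "k \<in> K"
    then have "0 \<le> x k mod c k" "x k mod c k < D" "0 \<le> y k mod c k" "y k mod c k < D"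
      using g(2,3)[OF k] pos_mod_bound[of "c k" "x k"] pos_mod_bound[of "c k" "y k"] pos_mod_sign[of "c k" "x k"] pos_mod_sign[of "c k" "y k"] by linarith+
    then show "cls k \<in> {1..D} \<times> {0..<D} \<times> {0..<D}" using g(2,3)[OF k] by (simp add: cls_def)
  qed
  then have "card (cls ` K) \<le> card ({1..D} \<times> {0..<D} \<times> {0..<D})"
    by (intro card_mono) auto
  also have "\<dots> = nat (D * D * D)" using D by (simp add: card_cartesian_product nat_mult_distrib)
  also have "\<dots> < card K" by (simp add: K_def)
  finally have "\<not> inj_on cls K" by (rule pigeonhole)
  then obtain k1 k2 where k: "k1 \<in> K" "k2 \<in> K" "k1 < k2" "cls k1 = cls k2"
    unfolding inj_on_def by (metis linorder_neqE_nat)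
  define x1 y1 x2 y2 d where "x1 = x k1" "y1 = y k1" "x2 = x k2" "y2 = y k2" "d = c k1"
  note defs = this
  have cls: "c k2 = d" "x1 mod d = x2 mod d" "y1 mod d = y2 mod d"
    using k(4) by (auto simp: cls_def defs)
  define L1 where "L1 = l ^ (2 * (T * k1))"
  define t where "t = T * (k2 - k1)"
  have k2: "l ^ (2 * (T * k2)) = L1 * l ^ (2 * t)"
  proof -
    have "2 * (T * k2) = 2 * (T * k1) + 2 * t"
      using k(3) by (simp add: t_def diff_mult_distrib2)
    then show ?thesis by (simp only: L1_def power_add)
  qed
  have n1: "x1\<^sup>2 + D * y1\<^sup>2 = d * L1" "L1 dvd x1 - r * y1" and d: "d > 0" "d \<le> D"
    using g(1-4)[OF k(1)] by (simp_all add: L1_def defs)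
  have n2: "x2\<^sup>2 + D * y2\<^sup>2 = d * (L1 * l ^ (2 * t))" "L1 * l ^ (2 * t) dvd x2 - r * y2"
    and prim: "\<not> (l dvd x2 \<and> l dvd y2)"
    using g(1,4,5)[OF k(2)] cls(1) by (simp_all add: k2[symmetric] defs)
  have L1: "L1 > 0" using l0 by (simp add: L1_def)
  have "coprime d l"
  proof -
    have "\<not> l dvd d" using zdvd_not_zless[of d l] d l by simp
    then show ?thesis using l(1) prime_imp_coprime coprime_commute by blast
  qed
  then have cop: "coprime d L1" by (simp add: L1_def)
  have rD: "L1 dvd r\<^sup>2 + D"
  proof -
    have "L1 dvd l ^ (2 * (T * Suc (nat (D * D * D))))"
      unfolding L1_def using k(1) by (intro le_imp_power_dvd mult_le_mono2) (auto simp: K_def)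
    then show ?thesis using r dvd_trans by blast
  qed
  have n2': "L1 dvd x2 - r * y2" using n2(2) dvd_mult_left by blast
  have dc: "d dvd x1 - x2" "d dvd y1 - y2" using cls by (simp_all add: mod_eq_dvd_iff)
  \<comment> \<open>\<open>P - Q w\<close> is the product of \<open>x2 + y2 w\<close> with the
    conjugate of \<open>x1 + y1 w\<close>. Divisibility by \<open>d\<close> comes from the equal
    residues, divisibility by \<open>L1\<close> from the common root \<open>r\<close>.\<close>
  define P where "P = x1 * x2 + D * y1 * y2"
  define Q where "Q = y1 * x2 - x1 * y2"
  have "d * L1 dvd P"
  proof (rule divides_mult)
    have "P = (x1\<^sup>2 + D * y1\<^sup>2) - x1 * (x1 - x2) - D * y1 * (y1 - y2)"
      by (simp add: P_def power2_eq_square algebra_simps)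
    then show "d dvd P" using dc n1(1) by simp
    have "P = (x1 - r * y1) * x2 + r * y1 * (x2 - r * y2) + (r\<^sup>2 + D) * (y1 * y2)"
      by (simp add: P_def power2_eq_square algebra_simps)
    then show "L1 dvd P" using n1(2) n2' rD by simp
  qed (rule cop)
  then obtain X where X: "P = d * L1 * X" by (rule dvdE)
  have "d * L1 dvd Q"
  proof (rule divides_mult)
    have "Q = (y1 - y2) * x1 - y1 * (x1 - x2)"
      by (simp add: Q_def algebra_simps)
    then show "d dvd Q" using dc by simp
    have "Q = y1 * (x2 - r * y2) - (x1 - r * y1) * y2"
      by (simp add: Q_def algebra_simps)
    then show "L1 dvd Q" using n1(2) n2' by simp
  qed (rule cop)
  then obtain Y where Y: "Q = d * L1 * Y" by (rule dvdE)
  have cL: "d * L1 \<noteq> 0" using d L1 by simp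
  have "(d * L1)\<^sup>2 * (X\<^sup>2 + D * Y\<^sup>2) = P\<^sup>2 + D * Q\<^sup>2"
    unfolding X Y by (simp add: power2_eq_square algebra_simps)
  also have "\<dots> = (x1\<^sup>2 + D * y1\<^sup>2) * (x2\<^sup>2 + D * y2\<^sup>2)"
    unfolding P_def Q_def by (simp add: power2_eq_square algebra_simps)
  also have "\<dots> = (d * L1)\<^sup>2 * l ^ (2 * t)"
    unfolding n1 n2 by (simp add: power2_eq_square algebra_simps)
  finally have norm: "X\<^sup>2 + D * Y\<^sup>2 = l ^ (2 * t)" using cL by simp
  \<comment> \<open>Multiplying the quotient \<open>X - Y w\<close> back by \<open>x1 + y1 w\<close>
    recovers \<open>x2 + y2 w\<close>, so a common factor of \<open>X\<close> and \<open>Y\<close>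
    divides both \<open>x2\<close> and \<open>y2\<close>.\<close>
  have "(d * L1) * x2 = x1 * P + D * y1 * Q" "(d * L1) * y2 = y1 * P - x1 * Q"
    unfolding n1(1)[symmetric] P_def Q_def by (simp_all add: power2_eq_square algebra_simps)
  then have "(d * L1) * x2 = (d * L1) * (x1 * X + D * y1 * Y)" "(d * L1) * y2 = (d * L1) * (y1 * X - x1 * Y)"
    unfolding X Y by (simp_all add: algebra_simps)
  then have x2: "x2 = x1 * X + D * y1 * Y" and y2: "y2 = y1 * X - x1 * Y"
    using cL mult_left_cancel by blast+
  have t: "t \<ge> T" using k(3) by (cases "k2 - k1") (simp_all add: t_def)
  then have "2 * t > 0" using T by simp
  then have ln: "l dvd X\<^sup>2 + D * Y\<^sup>2" unfolding norm by (simp add: dvd_power)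
  have "\<not> l dvd D" using zdvd_not_zless[of D l] D l by simp
  then have "l dvd X \<longleftrightarrow> l dvd Y"
    using prime_dvd_binary_form_iff[of l D 1 X Y] ln l D by simp
  moreover have "\<not> (l dvd X \<and> l dvd Y)" using prim x2 y2 by auto
  ultimately show thesis using that t norm by blast
qed

text \<open>Both representations have the same value \<open>q L\<close>, so \<open>L\<close> divides the difference of
  squares \<open>(m1 n2)\<^sup>2 - (m2 n1)\<^sup>2\<close>. As \<open>l\<close> cannot divide both factors, \<open>L\<close> divides one of them. The composition
  \<open>(q m1 m2 \<plusminus> p n1 n2)\<^sup>2 + p q (m1 n2 \<mp> m2 n1)\<^sup>2 = (q L)\<^sup>2\<close>
  then forces that factor to vanish.\<close>

lemma primitive_representation_unique:
  fixes l p q m1 n1 m2 n2 :: int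
  assumes l: "prime l" "odd l" and pq: "0 < q" "q < p"
    and pos: "m1 > 0" "n1 > 0" "m2 > 0" "n2 > 0"
    and nd: "\<not> l dvd m1" "\<not> l dvd n2"
    and e1: "q * m1\<^sup>2 + p * n1\<^sup>2 = q * l ^ s" and e2: "q * m2\<^sup>2 + p * n2\<^sup>2 = q * l ^ s"
  shows "m1 = m2 \<and> n1 = n2"
proof -
  define L where "L = l ^ s"
  have L: "L > 0" using l(1) by (simp add: L_def prime_gt_0_int)
  note e1 = e1[folded L_def] and e2 = e2[folded L_def]
  define A where "A = m1 * n2 - m2 * n1"
  define B where "B = m1 * n2 + m2 * n1"
  have "q * (A * B) = (q * m1\<^sup>2 + p * n1\<^sup>2) * n2\<^sup>2 - (q * m2\<^sup>2 + p * n2\<^sup>2) * n1\<^sup>2"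
    unfolding A_def B_def by (simp add: power2_eq_square algebra_simps)
  also have "\<dots> = q * (L * (n2\<^sup>2 - n1\<^sup>2))" unfolding e1 e2 by (simp add: power2_eq_square algebra_simps)
  finally have "A * B = L * (n2\<^sup>2 - n1\<^sup>2)" using pq by simp
  then have AB: "L dvd A * B" by simp
  have "\<not> l dvd 2 * (m1 * n2)"
    using nd l by (metis prime_dvd_multD primes_dvd_imp_eq two_is_prime even_numeral dvd_refl)
  moreover have "2 * (m1 * n2) = A + B" by (simp add: A_def B_def)
  ultimately have "\<not> (l dvd A \<and> l dvd B)" by auto
  then have "coprime L A \<or> coprime L B"
    unfolding L_def using prime_imp_coprime[OF l(1)] by auto
  then have dvd: "L dvd A \<or> L dvd B"
    using AB by (auto simp: coprime_dvd_mult_right_iff coprime_dvd_mult_left_iff)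
  \<comment> \<open>A nonzero multiple \<open>Y\<close> of \<open>L\<close> contributes at least
    \<open>p q L^2\<close>, which exceeds \<open>(q L)^2\<close> because
    \<open>q < p\<close>.\<close>
  have zero: "Y = 0" if "L dvd Y" "X\<^sup>2 + p * q * Y\<^sup>2 = (q * L)\<^sup>2" for X Y :: int
  proof (rule ccontr)
    assume "Y \<noteq> 0"
    then have "L \<le> \<bar>Y\<bar>" using dvd_imp_le_int[of Y L] that(1) L by simp
    then have "L\<^sup>2 \<le> Y\<^sup>2" using L abs_le_square_iff[of L Y] by simp
    then have "p * q * L\<^sup>2 \<le> p * q * Y\<^sup>2" using pq by simp
    also have "\<dots> \<le> X\<^sup>2 + p * q * Y\<^sup>2" by simp
    also have "\<dots> = q * q * L\<^sup>2" unfolding that(2) by (simp add: power2_eq_square)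
    finally show False using pq L by simp
  qed
  have "(q * m1 * m2 + p * n1 * n2)\<^sup>2 + p * q * A\<^sup>2 = (q * m1\<^sup>2 + p * n1\<^sup>2) * (q * m2\<^sup>2 + p * n2\<^sup>2)"
    unfolding A_def by (simp add: power2_eq_square algebra_simps)
  then have "L dvd A \<Longrightarrow> A = 0" using zero e1 e2 by (simp add: power2_eq_square)
  moreover
  have "(q * m1 * m2 - p * n1 * n2)\<^sup>2 + p * q * B\<^sup>2 = (q * m1\<^sup>2 + p * n1\<^sup>2) * (q * m2\<^sup>2 + p * n2\<^sup>2)"
    unfolding B_def by (simp add: power2_eq_square algebra_simps)
  then have "L dvd B \<Longrightarrow> B = 0" using zero e1 e2 by (simp add: power2_eq_square)
  moreover have "B > 0" using pos by (simp add: B_def add_pos_pos)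
  ultimately have "A = 0" using dvd by auto
  then have A: "m1 * n2 = m2 * n1" by (simp add: A_def)
  have "(q * L) * n2\<^sup>2 = q * (m1 * n2)\<^sup>2 + p * n1\<^sup>2 * n2\<^sup>2"
    unfolding e1[symmetric] by (simp add: power2_eq_square algebra_simps)
  also have "\<dots> = (q * L) * n1\<^sup>2"
    unfolding A e2[symmetric] by (simp add: power2_eq_square algebra_simps)
  finally have "n1 = n2" using pq L pos by (simp add: power2_eq_iff_nonneg)
  with A pos show ?thesis by simp
qed

section \<open>Counting representations\<close>

definition representations :: "nat \<Rightarrow> nat \<Rightarrow> nat \<Rightarrow> (nat \<times> nat) set" where
  "representations q p N = {(m, n). 0 < m \<and> 0 < n \<and> q * m\<^sup>2 + p * n\<^sup>2 = N}"

lemma finite_representations: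
  assumes "0 < q" "0 < p"
  shows "finite (representations q p N)"
proof (rule finite_subset)
  show "representations q p N \<subseteq> {..N} \<times> {..N}"
  proof (clarsimp simp: representations_def)
    fix m n :: nat
    have "m \<le> q * m\<^sup>2" "n \<le> p * n\<^sup>2"
      using assms by (simp_all add: power2_eq_square)
    then show "m \<le> q * m\<^sup>2 + p * n\<^sup>2 \<and> n \<le> q * m\<^sup>2 + p * n\<^sup>2" by linarith
  qed
qed simp

lemma nat_unit_steps_attain:
  fixes f :: "nat \<Rightarrow> nat"
  assumes "f 0 \<le> k" and step: "\<And>j. f (Suc j) \<le> Suc (f j)" and "k \<le> f n"
  shows "\<exists>j. f j = k"
  using \<open>k \<le> f n\<close>
proof (induction n)
  case 0
  then show ?case using assms(1) by (metis order_antisym)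
next
  case (Suc n)
  show ?case
  proof (cases "k \<le> f n")
    case False
    then have "f (Suc n) = k" using Suc.prems step[of n] by simp
    then show ?thesis by blast
  qed (rule Suc.IH)
qed

text \<open>The numbers \<open>z\<close> used are powers of one large prime. Their oddness serves
  the reduction of sums of two squares to the form \<open>m^2 + 4 n^2\<close>.\<close>

lemma ex_card_representations_eq:
  fixes p q k :: nat
  assumes pq: "0 < q" "q < p"
  shows "\<exists>z. odd z \<and> card (representations q p (q * z\<^sup>2)) = k"
proof -
  define D where "D = int p * int q"
  have D: "D > 0" using pq by (simp add: D_def)
  obtain l r where l: "prime l" "l > D + 1" "l dvd r\<^sup>2 + D"
    using exists_large_prime_dvd_square_plus[OF D] by blast
  have oddl: "odd l" using l D prime_odd_int[of l] by simp
  have "\<not> l dvd D" using zdvd_not_zless[of D l] D l by simp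
  then have roots: "\<exists>r. l ^ s dvd r\<^sup>2 + D" for s
    using sqrt_mod_prime_power l oddl by blast
  define c where "c = nat l"
  have c: "int c = l" "c > 0" using l D by (simp_all add: c_def)
  have oddc: "odd c" using oddl c by presburger
  define R where "R j = representations q p (q * (c ^ j)\<^sup>2)" for j
  have fin: "finite (R j)" for j
    unfolding R_def using pq by (intro finite_representations) auto
  have R_iff: "(m, n) \<in> R j \<longleftrightarrow> 0 < m \<and> 0 < n \<and>
      int q * (int m)\<^sup>2 + int p * (int n)\<^sup>2 = int q * l ^ (2 * j)" for m n j
  proof -
    have "q * m\<^sup>2 + p * n\<^sup>2 = q * (c ^ j)\<^sup>2 \<longleftrightarrow>
      int (q * m\<^sup>2 + p * n\<^sup>2) = int (q * (c ^ j)\<^sup>2)" by (simp only: of_nat_eq_iff)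
    then show ?thesis
      by (simp add: R_def representations_def c power_mult[symmetric] mult.commute)
  qed
  define scale where "scale = (\<lambda>(m, n). (c * m, c * n))"
  have inj: "inj_on scale A" for A
    using c by (auto simp: inj_on_def scale_def)
  have img: "scale ` R j \<subseteq> R (Suc j)" for j
  proof (rule image_subsetI)
    fix z assume "z \<in> R j"
    moreover obtain m n where z: "z = (m, n)" by fastforce
    ultimately have "(m, n) \<in> R j" by simp
    then have mn: "0 < m" "0 < n" "int q * (int m)\<^sup>2 + int p * (int n)\<^sup>2 = int q * l ^ (2 * j)"
      by (simp_all add: R_iff)
    have "int q * (l * int m)\<^sup>2 + int p * (l * int n)\<^sup>2 = l\<^sup>2 * (int q * (int m)\<^sup>2 + int p * (int n)\<^sup>2)"
      by (simp add: power2_eq_square algebra_simps)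
    also have "\<dots> = int q * l ^ (2 * Suc j)"
      unfolding mn(3) by (simp add: power2_eq_square)
    finally show "scale z \<in> R (Suc j)"
      using mn(1,2) c by (simp add: scale_def R_iff z)
  qed
  \<comment> \<open>\<open>P j\<close> collects the solutions that are new at level
    \<open>j + 1\<close>. They are the primitive ones: a solution with both entries divisible by
    \<open>c\<close> comes from level \<open>j\<close>.\<close>
  define P where "P j = R (Suc j) - scale ` R j" for j
  have cardR: "card (R (Suc j)) = card (R j) + card (P j)" for j
  proof -
    have "card (R (Suc j)) = card (scale ` R j \<union> P j)"
      using img[of j] by (intro arg_cong[where f = card]) (auto simp: P_def)
    also have "\<dots> = card (scale ` R j) + card (P j)"
      using fin by (intro card_Un_disjoint) (auto simp: P_def)
    finally show ?thesis by (simp add: card_image[OF inj])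
  qed
  have lp: "\<not> l dvd int p" "\<not> l dvd int q" using \<open>\<not> l dvd D\<close> by (auto simp: D_def)
  have prim: "\<not> l dvd int m \<and> \<not> l dvd int n" if "(m, n) \<in> P j" for m n j
  proof -
    have mn: "0 < m" "0 < n" "int q * (int m)\<^sup>2 + int p * (int n)\<^sup>2 = int q * l ^ (2 * Suc j)"
      using that by (simp_all only: P_def Diff_iff R_iff)
    have "l dvd int q * (int m)\<^sup>2 + int p * (int n)\<^sup>2" unfolding mn(3) by simp
    then have iff: "l dvd int m \<longleftrightarrow> l dvd int n"
      by (rule prime_dvd_binary_form_iff[OF l(1) lp])
    moreover have False if "l dvd int m" "l dvd int n"
    proof -
      from that obtain m' n' where m': "m = c * m'" "n = c * n'"
        unfolding c(1)[symmetric] int_dvd_int_iff by (auto elim!: dvdE)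
      have "l\<^sup>2 * (int q * (int m')\<^sup>2 + int p * (int n')\<^sup>2) = int q * (int m)\<^sup>2 + int p * (int n)\<^sup>2"
        by (simp add: m' c power2_eq_square algebra_simps)
      also have "\<dots> = l\<^sup>2 * (int q * l ^ (2 * j))"
        unfolding mn(3) by (simp add: power2_eq_square)
      finally have "l\<^sup>2 * (int q * (int m')\<^sup>2 + int p * (int n')\<^sup>2) = l\<^sup>2 * (int q * l ^ (2 * j))" .
      then have "int q * (int m')\<^sup>2 + int p * (int n')\<^sup>2 = int q * l ^ (2 * j)"
        using l D by simp
      then have "(m', n') \<in> R j" using mn m' by (simp add: R_iff)
      then have "(m, n) \<in> scale ` R j" by (force simp: m' scale_def)
      then show False using \<open>(m, n) \<in> P j\<close> by (simp add: P_def)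
    qed
    ultimately show ?thesis by blast
  qed
  have cardP: "card (P j) \<le> 1" for j
  proof -
    have "z = z'" if "z \<in> P j" "z' \<in> P j" for z z'
    proof -
      obtain m n m' n' where z: "z = (m, n)" "z' = (m', n')" by fastforce
      have "int m = int m' \<and> int n = int n'"
      proof (rule primitive_representation_unique[OF l(1) oddl])
        show "\<not> l dvd int m" "\<not> l dvd int n'" using that z prim by auto
        show "int q * (int m)\<^sup>2 + int p * (int n)\<^sup>2 = int q * l ^ (2 * Suc j)"
          "int q * (int m')\<^sup>2 + int p * (int n')\<^sup>2 = int q * l ^ (2 * Suc j)"
          using that by (simp_all only: P_def Diff_iff R_iff z)
      qed (use that pq in \<open>auto simp: P_def R_iff z\<close>)
      then show ?thesis using z by simp
    qed
    then show ?thesis using card_le_Suc0_iff_eq[of "P j"] fin by (auto simp: P_def)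
  qed
  have mono: "mono (\<lambda>j. card (R j))" unfolding mono_iff_le_Suc by (simp add: cardR)
  have unbounded: "\<exists>j. N \<le> card (R j)" for N
  proof (induction N)
    case (Suc N)
    then obtain j where j: "N \<le> card (R j)" by blast
    \<comment> \<open>A primitive solution beyond level \<open>j\<close> is new at its own level
      \<open>t\<close>, where at least \<open>N\<close> scaled solutions are already present by
      monotonicity.\<close>
    obtain t X Y where t: "t \<ge> Suc j" "X\<^sup>2 + D * Y\<^sup>2 = l ^ (2 * t)" "\<not> l dvd X" "\<not> l dvd Y"
      using primitive_norm_prime_power[OF l(1,2) D roots, of "Suc j"] by blast
    obtain t' where t': "t = Suc t'" using t(1) by (cases t) auto
    have XY: "X \<noteq> 0" "Y \<noteq> 0" using t by auto
    \<comment> \<open>Multiplying the norm equation by \<open>q\<close> turns a solution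
      \<open>(X, Y)\<close> into a representation by the form with coefficients \<open>q\<close> and
      \<open>p\<close>.\<close>
    have "int q * X\<^sup>2 + int p * (int q * Y)\<^sup>2 = int q * (X\<^sup>2 + D * Y\<^sup>2)"
      unfolding D_def by (simp add: power2_eq_square algebra_simps)
    then have "(nat \<bar>X\<bar>, nat \<bar>int q * Y\<bar>) \<in> R t"
      using t(2) XY pq by (simp add: R_iff)
    moreover have "(nat \<bar>X\<bar>, nat \<bar>int q * Y\<bar>) \<notin> scale ` R t'"
    proof
      assume "(nat \<bar>X\<bar>, nat \<bar>int q * Y\<bar>) \<in> scale ` R t'"
      then obtain m where "nat \<bar>X\<bar> = c * m" by (auto simp: scale_def)
      then have "\<bar>X\<bar> = l * int m" using c by (metis abs_ge_zero int_nat_eq of_nat_mult)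
      then show False using t(3) by (metis dvd_abs_iff dvd_triv_left)
    qed
    ultimately have "P t' \<noteq> {}" by (auto simp: P_def t')
    then have "card (P t') > 0" using fin by (auto simp: P_def card_gt_0_iff)
    moreover have "card (R j) \<le> card (R t')" using mono t(1) t' by (auto dest: monoD)
    ultimately have "Suc N \<le> card (R (Suc t'))" using cardR[of t'] j by linarith
    then show ?case by blast
  qed auto
  \<comment> \<open>Since \<open>n > 0\<close>, the term \<open>p n^2\<close> alone already exceeds
    \<open>q\<close>; the count therefore starts at 0.\<close>
  have "R 0 = {}"
  proof -
    have "q * m\<^sup>2 + p * n\<^sup>2 \<noteq> q" if "0 < m" "0 < n" for m n :: nat
    proof -
      have "p * 1 \<le> p * n\<^sup>2" using that by (intro mult_le_mono2) simp
      then show ?thesis using pq by linarith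
    qed
    then show ?thesis by (auto simp: R_def representations_def)
  qed
  moreover obtain n where "k \<le> card (R n)" using unbounded by blast
  moreover have "card (R (Suc j)) \<le> Suc (card (R j))" for j
    using cardR[of j] cardP[of j] by simp
  ultimately have "\<exists>j. card (R j) = k"
    using nat_unit_steps_attain[of "\<lambda>j. card (R j)" k] by simp
  then obtain j where "card (R j) = k" by blast
  then show ?thesis using oddc by (intro exI[of _ "c ^ j"]) (simp add: R_def)
qed

lemma card_representations_commute: "card (representations q p N) = card (representations p q N)"
proof -
  have "representations p q N = prod.swap ` representations q p N"
    by (force simp: representations_def image_iff add.commute)
  then show ?thesis by (simp add: card_image)
qed

text \<open>Exactly one of the two squares is even. Halving its root gives a solution of
  \<open>m^2 + 4 n^2 = N\<close>, and the two possible positions of the even entry account for the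
  factor 2.\<close>

lemma card_sums_of_two_squares_odd:
  fixes N :: nat
  assumes "odd N"
  shows "card (representations 1 1 N) = 2 * card (representations 1 4 N)"
proof -
  define f where "f = (\<lambda>(m::nat, n::nat). (m, 2 * n))"
  define g where "g = (\<lambda>(m::nat, n::nat). (2 * n, m))"
  let ?R = "representations 1 4 N"
  have fin: "finite ?R" by (rule finite_representations) auto
  have "representations 1 1 N = f ` ?R \<union> g ` ?R"
  proof (intro equalityI subsetI)
    fix z assume z: "z \<in> representations 1 1 N"
    then obtain m n where mn: "z = (m, n)" "0 < m" "0 < n" "m\<^sup>2 + n\<^sup>2 = N"
      by (auto simp: representations_def)
    show "z \<in> f ` ?R \<union> g ` ?R"
    proof (cases "even n")
      case True
      then obtain n' where "n = 2 * n'" by (rule evenE)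
      then have "(m, n') \<in> ?R" "z = f (m, n')"
        using mn by (auto simp: representations_def f_def power_mult_distrib)
      then show ?thesis by blast
    next
      case False
      then have "even m" using mn assms by auto
      then obtain m' where "m = 2 * m'" by (rule evenE)
      then have "(n, m') \<in> ?R" "z = g (n, m')"
        using mn by (auto simp: representations_def g_def power_mult_distrib)
      then show ?thesis by blast
    qed
  next
    fix z assume "z \<in> f ` ?R \<union> g ` ?R"
    then show "z \<in> representations 1 1 N"
      by (auto simp: representations_def f_def g_def power_mult_distrib)
  qed
  moreover have "f ` ?R \<inter> g ` ?R = {}"
  proof -
    have "odd m" if "(m, n) \<in> ?R" for m n
      using that assms by (auto simp: representations_def)
    then show ?thesis by (fastforce simp: f_def g_def)
  qed
  ultimately have "card (representations 1 1 N) = card (f ` ?R) + card (g ` ?R)"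
    using fin by (simp add: card_Un_disjoint)
  moreover have "inj_on f ?R" "inj_on g ?R" by (auto simp: inj_on_def f_def g_def)
  ultimately show ?thesis by (simp add: card_image)
qed

text \<open>Multiplication by \<open>1 + i\<close> doubles norms in the Gaussian integers and is, up
  to signs, a bijection between the solutions. Oddness of \<open>z\<close> excludes
  \<open>s = t\<close>, which would produce a zero coordinate. The extra solution supplies the odd
  representation numbers.\<close>

lemma card_sums_of_two_squares_twice_odd_square:
  fixes z :: nat
  assumes "odd z"
  shows "card (representations 1 1 (2 * z\<^sup>2)) = Suc (card (representations 1 1 (z\<^sup>2)))"
proof -
  let ?R = "representations 1 1 (z\<^sup>2)"
  \<comment> \<open>\<open>(s, t)\<close> with \<open>s > t\<close> goes to \<open>(s + t, s - t)\<close> and with \<open>s < t\<close> to \<open>(t - s, s + t)\<close>;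
     the pair \<open>(z, z)\<close> comes from the omitted \<open>(z, 0)\<close>.\<close>
  define f where "f = (\<lambda>(s::nat, t). if t < s then (s + t, s - t) else (t - s, s + t))"
  have fin: "finite ?R" by (rule finite_representations) auto
  have ne: "s \<noteq> t" if "(s, t) \<in> ?R" for s t
  proof
    assume "s = t"
    then have "z\<^sup>2 = 2 * s\<^sup>2" using that by (simp add: representations_def)
    then show False using assms by (metis dvd_triv_left even_power)
  qed
  have sq: "(s + t)\<^sup>2 + (s - t)\<^sup>2 = 2 * (s\<^sup>2 + t\<^sup>2)" if "t \<le> s" for s t :: nat
  proof -
    from that obtain d where "s = t + d" by (metis le_Suc_ex)
    then show ?thesis by (simp add: power2_eq_square algebra_simps)
  qed
  have "representations 1 1 (2 * z\<^sup>2) = insert (z, z) (f ` ?R)"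
  proof (intro equalityI subsetI)
    fix w assume "w \<in> representations 1 1 (2 * z\<^sup>2)"
    then obtain m n where mn: "w = (m, n)" "0 < m" "0 < n" "m\<^sup>2 + n\<^sup>2 = 2 * z\<^sup>2"
      by (auto simp: representations_def)
    have "even (m\<^sup>2 + n\<^sup>2)" using mn by simp
    then have par: "even (m + n)" by simp
    consider "m = n" | "n < m" | "m < n" by linarith
    then show "w \<in> insert (z, z) (f ` ?R)"
    proof cases
      case 1
      have "m\<^sup>2 = z\<^sup>2" using mn(4) unfolding 1 by linarith
      then have "m = z" by (simp add: power2_eq_iff_nonneg)
      then show ?thesis using 1 mn(1) by simp
    next
      case 2
      have "even (m - n)" using 2 par by auto
      then obtain t where t: "m - n = 2 * t" by (rule evenE)
      define s where "s = n + t"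
      have st: "m = s + t" "n = s - t" "t < s" "0 < t" using t 2 mn by (auto simp: s_def)
      then have "(s, t) \<in> ?R" using mn sq[of t s] by (simp add: representations_def)
      moreover have "w = f (s, t)" using st mn by (simp add: f_def)
      ultimately show ?thesis by blast
    next
      case 3
      have "even (n - m)" using 3 par by auto
      then obtain s where s: "n - m = 2 * s" by (rule evenE)
      define t where "t = m + s"
      have st: "n = s + t" "m = t - s" "s < t" "0 < s" using s 3 mn by (auto simp: t_def)
      then have "(s, t) \<in> ?R" using mn sq[of s t] by (simp add: representations_def add.commute)
      moreover have "w = f (s, t)" using st mn by (simp add: f_def)
      ultimately show ?thesis by blast
    qed
  next
    fix w assume "w \<in> insert (z, z) (f ` ?R)"
    then consider "w = (z, z)" | s t where "(s, t) \<in> ?R" "w = f (s, t)" by force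
    then show "w \<in> representations 1 1 (2 * z\<^sup>2)"
    proof cases
      case 1
      then show ?thesis using assms by (auto simp: representations_def intro: Nat.gr0I)
    next
      case 2
      then show ?thesis using ne[of s t] sq[of s t] sq[of t s]
        by (auto simp: representations_def f_def add.commute)
    qed
  qed
  moreover have "(z, z) \<notin> f ` ?R"
  proof
    assume "(z, z) \<in> f ` ?R"
    then obtain s t where "(s, t) \<in> ?R" "f (s, t) = (z, z)" by force
    then show False by (auto simp: f_def representations_def split: if_splits)
  qed
  moreover have "inj_on f ?R"
  proof (rule inj_onI)
    fix u v assume "u \<in> ?R" "v \<in> ?R" "f u = f v"
    then show "u = v"
      by (cases u; cases v) (auto simp: f_def representations_def split: if_splits)
  qed
  ultimately show ?thesis using fin by (simp add: card_image)
qed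

lemma all_representation_numbers_occur:
  fixes p q k :: nat
  assumes "0 < p" "0 < q"
  shows "\<exists>N. card (representations q p N) = k"
proof -
  consider "q < p" | "p < q" | "p = q" by linarith
  then show ?thesis
  proof cases
    case 1
    then show ?thesis using ex_card_representations_eq assms by blast
  next
    case 2
    then show ?thesis
      using ex_card_representations_eq[of p q k] assms card_representations_commute by metis
  next
    case 3
    have scale: "representations q p (q * N) = representations 1 1 N" for N
      using 3 assms by (simp add: representations_def flip: distrib_left)
    \<comment> \<open>Doubling \<open>k div 2\<close> gives \<open>k\<close> if \<open>k\<close> is
      even; for odd \<open>k\<close> the missing 1 comes from passing to
      \<open>2 z^2\<close>.\<close>
    obtain z where z: "odd z" "card (representations 1 4 (z\<^sup>2)) = k div 2"
      using ex_card_representations_eq[of 1 4 "k div 2"] by auto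
    have "card (representations 1 1 (z\<^sup>2)) = 2 * (k div 2)"
      using card_sums_of_two_squares_odd[of "z\<^sup>2"] z by simp
    then have "card (representations 1 1 (z\<^sup>2)) = k \<or> card (representations 1 1 (2 * z\<^sup>2)) = k"
      using card_sums_of_two_squares_twice_odd_square[OF z(1)] by presburger
    then show ?thesis using scale by metis
  qed
qed

section \<open>The sine system\<close>

lemma rectangle_eq_cbox: "{0..a} \<times> {0..b} = cbox (0::real, 0::real) (a, b)"
  by (auto simp: cbox_Pair_eq)

text \<open>The product of \<open>sin (m w x)\<close> and \<open>cos (w x)\<close> is the mean of
  the sines of frequencies \<open>m + 1\<close> and \<open>m - 1\<close>, so each cosine factor can
  be traded for a shift of \<open>m\<close>. Only \<open>m = 1\<close> is used later, where the
  weights become polynomials in \<open>cos (w x)\<close>.\<close>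

lemma sine_moments_zero:
  fixes f :: "real \<Rightarrow> real" and w :: real and m :: nat
  assumes f: "continuous_on {0..a} f"
    and zero: "\<And>m::nat. integral {0..a} (\<lambda>x. f x * sin (real m * w * x)) = 0"
  shows "integral {0..a} (\<lambda>x. f x * sin (m * w * x) * cos (w * x) ^ k) = 0"
proof (induction k arbitrary: m)
  case 0
  then show ?case using zero by simp
next
  case (Suc k)
  define h where "h m = (\<lambda>x. f x * sin (real m * w * x) * cos (w * x) ^ k)" for m
  have int: "h m integrable_on {0..a}" for m
    unfolding h_def by (intro integrable_continuous_interval continuous_intros f)
  show ?case
  proof (cases m)
    case (Suc j)
    have "f x * sin (m * w * x) * cos (w * x) ^ Suc k = (h (Suc m) x + h j x) / 2" for x
    proof -
      have "sin (m * w * x) * cos (w * x) = (sin (m * w * x + w * x) + sin (m * w * x - w * x)) / 2"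
        by (simp add: sin_times_cos)
      also have "m * w * x + w * x = Suc m * w * x" by (simp add: algebra_simps)
      also have "m * w * x - w * x = j * w * x" using Suc by (simp add: algebra_simps)
      finally have "sin (m * w * x) * cos (w * x) = (sin (Suc m * w * x) + sin (j * w * x)) / 2" .
      moreover have "f x * sin (m * w * x) * cos (w * x) ^ Suc k =
          f x * (sin (m * w * x) * cos (w * x)) * cos (w * x) ^ k" by simp
      ultimately have "f x * sin (m * w * x) * cos (w * x) ^ Suc k =
          f x * ((sin (Suc m * w * x) + sin (j * w * x)) / 2) * cos (w * x) ^ k" by metis
      then show ?thesis by (simp add: h_def algebra_simps add_divide_distrib)
    qed
    then have "integral {0..a} (\<lambda>x. f x * sin (m * w * x) * cos (w * x) ^ Suc k) =
        integral {0..a} (\<lambda>x. (h (Suc m) x + h j x) / 2)" by (rule integral_cong)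
    also have "\<dots> = (integral {0..a} (h (Suc m)) + integral {0..a} (h j)) / 2"
      by (simp add: integral_add[OF int int])
    also have "\<dots> = 0" using Suc.IH[of "Suc m"] Suc.IH[of j] by (simp add: h_def)
    finally show ?thesis .
  qed simp
qed

text \<open>With \<open>g x = f x sin (w x)\<close>, all integrals of \<open>g\<close> against
  polynomials in \<open>cos (w x)\<close> vanish. By Weierstrass such polynomials approximate
  \<open>g\<close> itself uniformly, so the integral of \<open>g^2\<close> is 0. The sine is
  positive inside the interval, and continuity handles the endpoints.\<close>

lemma sine_system_complete:
  fixes f :: "real \<Rightarrow> real"
  assumes a: "a > 0" and f: "continuous_on {0..a} f"
    and zero: "\<And>m::nat. m > 0 \<Longrightarrow> integral {0..a} (\<lambda>x. f x * sin (real m * (pi / a) * x)) = 0"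
    and x: "x \<in> {0..a}"
  shows "f x = 0"
proof -
  define w where "w = pi / a"
  have w: "w > 0" using a by (simp add: w_def)
  have zero': "integral {0..a} (\<lambda>x. f x * sin (real m * w * x)) = 0" for m
    using zero[of m] by (cases "m = 0") (simp_all add: w_def)
  define g where "g x = f x * sin (w * x)" for x
  have g: "continuous_on {0..a} g" unfolding g_def by (intro continuous_intros f)
  have cosmom: "integral {0..a} (\<lambda>x. g x * cos (w * x) ^ k) = 0" for k
    using sine_moments_zero[OF f zero', of 1 k] by (simp add: g_def)
  have sq_int: "(\<lambda>x. g x * g x) integrable_on {0..a}" "(\<lambda>x. \<bar>g x\<bar>) integrable_on {0..a}"
    by (intro integrable_continuous_interval continuous_intros g)+
  have small: "integral {0..a} (\<lambda>x. g x * g x) \<le> e * integral {0..a} (\<lambda>x. \<bar>g x\<bar>)" if e: "e > 0" for e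
  proof -
    have wx: "w * x \<in> {0..pi}" if "x \<in> {0..a}" for x
      using that a by (auto simp: w_def field_simps)
    \<comment> \<open>The substitution \<open>u = cos (w x)\<close> maps \<open>{0..a}\<close>
      bijectively onto \<open>{-1..1}\<close>, where polynomial approximation applies.\<close>
    have "continuous_on {-1..1} (\<lambda>u. g (arccos u / w))"
    proof (rule continuous_on_compose2[OF g])
      show "continuous_on {-1..1} (\<lambda>u. arccos u / w)"
        using w by (intro continuous_intros) auto
      show "(\<lambda>u. arccos u / w) ` {-1..1} \<subseteq> {0..a}"
        using arccos_lbound arccos_ubound a by (auto simp: w_def field_simps)
    qed
    then obtain P where P: "real_polynomial_function P" "\<And>u. u \<in> {-1..1} \<Longrightarrow> \<bar>g (arccos u / w) - P u\<bar> < e"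
      using Stone_Weierstrass_real_polynomial_function[of "{-1..1}" "\<lambda>u. g (arccos u / w)" e] e by auto
    then obtain c n where c: "P = (\<lambda>u. \<Sum>i\<le>n. c i * u ^ i)" using real_polynomial_function_iff_sum by blast
    have gP: "\<bar>g x - P (cos (w * x))\<bar> \<le> e" if "x \<in> {0..a}" for x
    proof -
      have "arccos (cos (w * x)) / w = x" using wx[OF that] w by (simp add: arccos_cos)
      then show ?thesis using P(2)[of "cos (w * x)"] by simp
    qed
    have contP: "continuous_on {0..a} (\<lambda>x. P (cos (w * x)))"
      unfolding c by (intro continuous_intros)
    have "integral {0..a} (\<lambda>x. g x * P (cos (w * x))) = integral {0..a} (\<lambda>x. \<Sum>i\<le>n. c i * (g x * cos (w * x) ^ i))"
      by (simp add: c sum_distrib_left mult_ac)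
    also have "\<dots> = (\<Sum>i\<le>n. integral {0..a} (\<lambda>x. c i * (g x * cos (w * x) ^ i)))"
      by (intro integral_sum integrable_continuous_interval continuous_intros g) auto
    also have "\<dots> = 0" by (simp add: cosmom)
    finally have "integral {0..a} (\<lambda>x. g x * g x) =
        integral {0..a} (\<lambda>x. g x * g x) - integral {0..a} (\<lambda>x. g x * P (cos (w * x)))" by simp
    also have "\<dots> = integral {0..a} (\<lambda>x. g x * g x - g x * P (cos (w * x)))"
      by (intro integral_diff[symmetric] integrable_continuous_interval continuous_intros g contP)
    also have "\<dots> \<le> integral {0..a} (\<lambda>x. e * \<bar>g x\<bar>)"
    proof (rule integral_le)
      fix x assume x: "x \<in> {0..a}"
      have "g x * g x - g x * P (cos (w * x)) = g x * (g x - P (cos (w * x)))" by (simp add: algebra_simps)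
      also have "\<dots> \<le> \<bar>g x\<bar> * \<bar>g x - P (cos (w * x))\<bar>" by (metis abs_ge_self abs_mult)
      also have "\<dots> \<le> \<bar>g x\<bar> * e" using gP[OF x] by (intro mult_left_mono) auto
      finally show "g x * g x - g x * P (cos (w * x)) \<le> e * \<bar>g x\<bar>" by (simp add: mult.commute)
    qed (intro integrable_continuous_interval continuous_intros g contP)+
    finally show ?thesis by simp
  qed
  define M where "M = integral {0..a} (\<lambda>x. \<bar>g x\<bar>)"
  have M: "M \<ge> 0" unfolding M_def by (rule integral_nonneg[OF sq_int(2)]) auto
  have "integral {0..a} (\<lambda>x. g x * g x) \<le> 0 + e" if "e > 0" for e
  proof -
    \<comment> \<open>The denominator \<open>M + 1\<close> rather than \<open>M\<close> covers the
      case \<open>M = 0\<close>.\<close>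
    have "integral {0..a} (\<lambda>x. g x * g x) \<le> e / (M + 1) * M"
      using small[of "e / (M + 1)"] that M by (simp add: M_def)
    also have "\<dots> \<le> e" using that M by (simp add: field_simps)
    finally show ?thesis by simp
  qed
  then have "integral {0..a} (\<lambda>x. g x * g x) \<le> 0" by (rule field_le_epsilon)
  moreover have "integral {0..a} (\<lambda>x. g x * g x) \<ge> 0" by (rule integral_nonneg[OF sq_int(1)]) auto
  ultimately have "integral {0..a} (\<lambda>x. g x * g x) = 0" by simp
  then have "\<forall>x\<in>{0..a}. g x * g x = 0"
    using integral_eq_0_iff[of 0 a "\<lambda>x. g x * g x"] a g by (simp add: continuous_on_mult)
  then have g0: "g x = 0" if "x \<in> {0..a}" for x using that by auto
  have "f x = 0" if "x \<in> {0<..<a}" for x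
  proof -
    have "sin (w * x) > 0" using that a by (intro sin_gt_zero) (auto simp: w_def field_simps)
    then show ?thesis using g0[of x] that by (auto simp: g_def)
  qed
  then show ?thesis
    using continuous_constant_on_closure[of "{0<..<a}" f 0 x] f x a by simp
qed

lemma integral_sine_product:
  fixes m n :: nat
  assumes a: "a > 0" and "m > 0" "n > 0"
  shows "integral {0..a} (\<lambda>x. sin (m * (pi / a) * x) * sin (n * (pi / a) * x)) = (if m = n then a / 2 else 0)"
proof -
  define w where "w = pi / a"
  have w: "w \<noteq> 0" "w * a = pi" using a by (simp_all add: w_def)
  have prod: "sin (m * w * x) * sin (n * w * x) = (cos ((real m - real n) * w * x) - cos ((real m + real n) * w * x)) / 2" for x
    by (simp add: sin_times_sin algebra_simps)
  have C: "((\<lambda>x. cos (of_int j * w * x)) has_integral (if j = 0 then a else 0)) {0..a}" for j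
  proof (cases "j = 0")
    case True
    then show ?thesis using has_integral_const_real[of "1::real" 0 a] a by simp
  next
    case False
    have "((\<lambda>x. cos (of_int j * w * x)) has_integral
       (sin (of_int j * w * a) / (of_int j * w) - sin (of_int j * w * 0) / (of_int j * w))) {0..a}"
      using a w False
      by (intro fundamental_theorem_of_calculus)
        (auto intro!: derivative_eq_intros simp flip: has_real_derivative_iff_has_vector_derivative)
    moreover have "sin (of_int j * w * a) = 0" using w by (simp add: mult.assoc sin_zero_iff_int2)
    ultimately show ?thesis using False by simp
  qed
  have "((\<lambda>x. (cos (of_int (int m - int n) * w * x) - cos (of_int (int m + int n) * w * x)) / 2)
      has_integral ((if int m - int n = 0 then a else 0) - (if int m + int n = 0 then a else 0)) / 2) {0..a}"
    by (intro has_integral_divide has_integral_diff C)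
  then have "((\<lambda>x. sin (m * w * x) * sin (n * w * x)) has_integral (if m = n then a / 2 else 0)) {0..a}"
    using assms by (auto simp: prod split: if_splits)
  then show ?thesis by (simp add: w_def integral_unique)
qed

text \<open>Two integrations by parts, packed into the antiderivative \<open>F\<close>. The sine
  vanishes at both ends, so only boundary values of \<open>w\<close> survive. The two-sided
  derivatives at the endpoints exist for the contracted eigenfunctions to which this is
  applied.\<close>

lemma integral_second_derivative_sine:
  fixes w w' w'' :: "real \<Rightarrow> real" and m :: nat
  assumes a: "a > 0"
    and w: "\<And>x. x \<in> {0..a} \<Longrightarrow> (w has_real_derivative w' x) (at x)"
    and w': "\<And>x. x \<in> {0..a} \<Longrightarrow> (w' has_real_derivative w'' x) (at x)"
  shows "((\<lambda>x. (w'' x + (m * (pi / a))\<^sup>2 * w x) * sin (m * (pi / a) * x)) has_integral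
     (m * (pi / a)) * (w 0 - (-1) ^ m * w a)) {0..a}"
proof -
  define k where "k = m * (pi / a)"
  define F where "F x = w' x * sin (k * x) - k * w x * cos (k * x)" for x
  have ka: "k * a = pi * m" using a by (simp add: k_def)
  have "((\<lambda>x. (w'' x + k\<^sup>2 * w x) * sin (k * x)) has_integral (F a - F 0)) {0..a}"
  proof (rule fundamental_theorem_of_calculus)
    fix x assume x: "x \<in> {0..a}"
    have "(F has_real_derivative (w'' x + k\<^sup>2 * w x) * sin (k * x)) (at x)"
      unfolding F_def
      by (rule derivative_eq_intros w[OF x] w'[OF x] refl | simp add: power2_eq_square algebra_simps)+
    then show "(F has_vector_derivative (w'' x + k\<^sup>2 * w x) * sin (k * x)) (at x within {0..a})"
      by (simp add: has_real_derivative_iff_has_vector_derivative has_vector_derivative_at_within)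
  qed (use a in simp)
  moreover have "F a - F 0 = k * (w 0 - (-1) ^ m * w a)"
    unfolding F_def ka by (simp add: sin_npi2 cos_npi2 algebra_simps)
  ultimately show ?thesis by (simp add: k_def)
qed

section \<open>Sine modes on the rectangle\<close>

definition sine_mode :: "real \<Rightarrow> real \<Rightarrow> nat \<times> nat \<Rightarrow> real \<times> real \<Rightarrow> real" where
  "sine_mode a b = (\<lambda>(m, n) (x, y). sin (m * (pi / a) * x) * sin (n * (pi / b) * y))"

lemma continuous_on_sine_mode: "continuous_on S (sine_mode a b i)"
proof -
  have "continuous_on S (\<lambda>p::real \<times> real. sin (u * fst p) * sin (v * snd p))" for u v :: real
    by (intro continuous_intros)
  then show ?thesis unfolding sine_mode_def case_prod_unfold .
qed

text \<open>Fubini reduces to one variable twice: for each \<open>n\<close>, the partial coefficient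
  \<open>h n\<close> has vanishing sine coefficients in \<open>x\<close>, hence is 0; then each
  slice of \<open>f\<close> at fixed \<open>x\<close> has vanishing sine coefficients in
  \<open>y\<close>.\<close>

lemma sine_modes_complete:
  fixes f :: "real \<times> real \<Rightarrow> real"
  assumes ab: "a > 0" "b > 0" and f: "continuous_on ({0..a} \<times> {0..b}) f"
    and zero: "\<And>m n. m > 0 \<Longrightarrow> n > 0 \<Longrightarrow>
      integral ({0..a} \<times> {0..b}) (\<lambda>p. f p * sine_mode a b (m, n) p) = 0"
    and p: "p \<in> {0..a} \<times> {0..b}"
  shows "f p = 0"
proof -
  define h where "h n = (\<lambda>x. integral {0..b} (\<lambda>y. f (x, y) * sin (real n * (pi / b) * y)))" for n
  have h_cont: "continuous_on {0..a} (h n)" for n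
    unfolding h_def cbox_interval[symmetric]
  proof (rule integral_continuous_on_param)
    have "continuous_on ({0..a} \<times> {0..b}) (\<lambda>p. f p * sin (u * snd p))" for u
      using f by (intro continuous_intros)
    then show "continuous_on (cbox 0 a \<times> cbox 0 b) (\<lambda>(x, y). f (x, y) * sin (real n * (pi / b) * y))"
      unfolding case_prod_unfold prod.collapse cbox_interval .
  qed
  have h0: "h n x = 0" if "n > 0" "x \<in> {0..a}" for n x
  proof -
    have "integral {0..a} (\<lambda>x. h n x * sin (real m * (pi / a) * x)) = 0" if m: "m > 0" for m :: nat
    proof -
      have "0 = integral (cbox (0, 0) (a, b)) (\<lambda>p. f p * sine_mode a b (m, n) p)"
        using zero[OF m \<open>n > 0\<close>] by (simp only: rectangle_eq_cbox)
      also have "\<dots> = integral (cbox 0 a) (\<lambda>x. integral (cbox 0 b) (\<lambda>y. f (x, y) * sine_mode a b (m, n) (x, y)))"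
        using f by (intro integral_prod_continuous continuous_intros continuous_on_sine_mode)
          (simp add: rectangle_eq_cbox)
      also have "\<dots> = integral {0..a} (\<lambda>x. h n x * sin (m * (pi / a) * x))"
      proof -
        have "integral {0..b} (\<lambda>y. f (x, y) * sine_mode a b (m, n) (x, y)) = h n x * sin (m * (pi / a) * x)" for x
          unfolding h_def integral_mult_left[symmetric] by (simp add: sine_mode_def mult_ac)
        then show ?thesis by (simp del: integral_mult_left integral_mult_right)
      qed
      finally show ?thesis by simp
    qed
    from sine_system_complete[OF ab(1) h_cont this that(2)] show ?thesis .
  qed
  obtain x y where xy: "p = (x, y)" "x \<in> {0..a}" "y \<in> {0..b}" using p by blast
  have "f (x, y) = 0"
  proof (rule sine_system_complete[OF ab(2) _ _ xy(3), of "\<lambda>y. f (x, y)"])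
    show "continuous_on {0..b} (\<lambda>y. f (x, y))"
      using xy by (intro continuous_on_compose2[OF f] continuous_intros) auto
    show "integral {0..b} (\<lambda>y. f (x, y) * sin (real n * (pi / b) * y)) = 0" if "n > 0" for n
      using h0[OF that xy(2)] by (simp add: h_def)
  qed
  then show ?thesis using xy by simp
qed

lemma integral_sine_mode_product:
  assumes ab: "a > 0" "b > 0" and "0 < fst i" "0 < snd i" "0 < fst j" "0 < snd j"
  shows "integral ({0..a} \<times> {0..b}) (\<lambda>p. sine_mode a b i p * sine_mode a b j p) =
    (if i = j then a * b / 4 else 0)"
proof -
  obtain m n m' n' where ij: "i = (m, n)" "j = (m', n')" by fastforce
  have "integral (cbox (0, 0) (a, b)) (\<lambda>p. sine_mode a b i p * sine_mode a b j p) =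
      integral (cbox 0 a) (\<lambda>x. integral (cbox 0 b) (\<lambda>y. sine_mode a b i (x, y) * sine_mode a b j (x, y)))"
    by (intro integral_prod_continuous continuous_intros continuous_on_sine_mode)
  also have "\<dots> = integral {0..a} (\<lambda>x. (sin (m * (pi / a) * x) * sin (m' * (pi / a) * x)) *
      integral {0..b} (\<lambda>y. sin (n * (pi / b) * y) * sin (n' * (pi / b) * y)))"
    unfolding integral_mult_right[symmetric] by (simp add: ij sine_mode_def mult_ac)
  also have "\<dots> = (if m = m' then a / 2 else 0) * (if n = n' then b / 2 else 0)"
    using integral_sine_product[of a m m'] integral_sine_product[of b n n'] assms
    by (simp add: ij)
  finally show ?thesis by (auto simp: rectangle_eq_cbox ij)
qed

section \<open>Green's identity for classical eigenfunctions\<close>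

lemma C1_onD:
  assumes "C1_on U u" "(x, y) \<in> U"
  shows "((\<lambda>s. u (s, y)) has_real_derivative partial_x u (x, y)) (at x)"
    "((\<lambda>s. u (x, s)) has_real_derivative partial_y u (x, y)) (at y)"
  using assms by (auto simp: C1_on_def partial_x_def partial_y_def DERIV_deriv_iff_real_differentiable)

text \<open>Nothing is known about the derivatives of \<open>V\<close> near the boundary, so Green's identity is
  applied to the contraction \<open>V (centre + t (p - centre))\<close> with \<open>t < 1\<close>, whose derivatives are
  continuous on the closed rectangle, and then \<open>t\<close> tends to 1.\<close>

lemma eigenfunction_orthogonal_sine_mode:
  assumes ab: "a > 0" "b > 0" and V: "V \<in> dirichlet_eigenspace ({0..a} \<times> {0..b}) \<mu>"
    and ne: "(m * (pi / a))\<^sup>2 + (n * (pi / b))\<^sup>2 \<noteq> \<mu>"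
  shows "integral ({0..a} \<times> {0..b}) (\<lambda>p. V p * sine_mode a b (m, n) p) = 0"
proof -
  define k where "k = m * (pi / a)"
  define l where "l = n * (pi / b)"
  let ?R = "{0..a} \<times> {0..b}"
  let ?I = "{0<..<a} \<times> {0<..<b}"
  have cl: "closure ?R = ?R" by (simp add: closure_Times)
  have int: "interior ?R = ?I" by (simp add: interior_Times)
  have Vc: "continuous_on ?R V" and C2: "C2_on ?I V"
    and eq: "\<And>p. p \<in> ?I \<Longrightarrow> - laplacian V p = \<mu> * V p"
    and bd: "\<And>p. p \<in> ?R - ?I \<Longrightarrow> V p = 0"
    using V unfolding dirichlet_eigenspace_def cl int frontier_def by blast+
  define A where "A t x = a / 2 + t * (x - a / 2)" for t x
  define B where "B t y = b / 2 + t * (y - b / 2)" for t y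
  have contract: "c / 2 + t * (x - c / 2) \<in> {0..c}" if "t \<in> {0..1}" "x \<in> {0..c}" for t x c :: real
  proof -
    have "\<bar>t * (x - c / 2)\<bar> \<le> 1 * (c / 2)"
      unfolding abs_mult using that by (intro mult_mono) (auto simp: abs_real_def)
    then have "t * (x - c / 2) \<le> c / 2 \<and> - (t * (x - c / 2)) \<le> c / 2"
      by (simp only: abs_le_iff mult_1)
    then show ?thesis unfolding atLeastAtMost_iff by linarith
  qed
  have contract': "c / 2 + t * (x - c / 2) \<in> {0<..<c}" if "t \<in> {0<..<1}" "x \<in> {0..c}" "c > 0" for t x c :: real
  proof -
    have "\<bar>t * (x - c / 2)\<bar> \<le> t * (c / 2)"
      unfolding abs_mult using that by (intro mult_mono) (auto simp: abs_real_def)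
    also have "\<dots> < c / 2" using that by simp
    finally have "t * (x - c / 2) < c / 2 \<and> - (t * (x - c / 2)) < c / 2"
      by (simp only: abs_less_iff)
    then show ?thesis unfolding greaterThanLessThan_iff by linarith
  qed
  have AB: "A t x \<in> {0..a}" if "t \<in> {0..1}" "x \<in> {0..a}" for t x
    unfolding A_def by (rule contract[OF that])
  have BB: "B t y \<in> {0..b}" if "t \<in> {0..1}" "y \<in> {0..b}" for t y
    unfolding B_def by (rule contract[OF that])
  have AI: "A t x \<in> {0<..<a}" if "t \<in> {0<..<1}" "x \<in> {0..a}" for t x
    unfolding A_def by (rule contract'[OF that ab(1)])
  have BI: "B t y \<in> {0<..<b}" if "t \<in> {0<..<1}" "y \<in> {0..b}" for t y
    unfolding B_def by (rule contract'[OF that ab(2)])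
  define W where "W t p = V (A t (fst p), B t (snd p))" for t p
  have Wc: "continuous_on ({0..1} \<times> ?R) (\<lambda>(t, p). W t p)"
    unfolding W_def case_prod_unfold
  proof (rule continuous_on_compose2[OF Vc])
    show "continuous_on ({0..1} \<times> ?R) (\<lambda>z. (A (fst z) (fst (snd z)), B (fst z) (snd (snd z))))"
      unfolding A_def B_def by (intro continuous_intros)
  qed (auto simp: image_subset_iff simp del: atLeastAtMost_iff intro!: AB BB)
  \<comment> \<open>\<open>\<Phi> t\<close> is the volume term of Green's identity minus its
    boundary terms. The contraction scales the Laplacian by \<open>t^2\<close>, so
    \<open>W t\<close> is an eigenfunction for \<open>\<mu> t^2\<close>.\<close>
  define \<Phi> where "\<Phi> t = (k\<^sup>2 + l\<^sup>2 - \<mu> * t\<^sup>2) * integral (cbox (0, 0) (a, b)) (\<lambda>p. W t p * sine_mode a b (m, n) p)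
     - integral (cbox 0 b) (\<lambda>y. k * (W t (0, y) - (-1) ^ m * W t (a, y)) * sin (l * y))
     - integral (cbox 0 a) (\<lambda>x. l * (W t (x, 0) - (-1) ^ n * W t (x, b)) * sin (k * x))" for t
  have "\<Phi> t = 0" if t: "t \<in> {0<..<1}" for t
  proof -
    define Vxx where "Vxx x y = t\<^sup>2 * partial_x (partial_x V) (A t x, B t y)" for x y
    define Vyy where "Vyy x y = t\<^sup>2 * partial_y (partial_y V) (A t x, B t y)" for x y
    have C1: "C1_on ?I V" "C1_on ?I (partial_x V)" "C1_on ?I (partial_y V)"
      using C2 by (simp_all add: C2_on_def)
    have inI: "(A t x, B t y) \<in> ?I" if "x \<in> {0..a}" "y \<in> {0..b}" for x y
      using AI[OF t that(1)] BI[OF t that(2)] by simp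
    have dA: "(A t has_real_derivative t) (at x)" for x
      unfolding A_def by (auto intro!: derivative_eq_intros)
    have dB: "(B t has_real_derivative t) (at y)" for y
      unfolding B_def by (auto intro!: derivative_eq_intros)
    \<comment> \<open>The integrand is split by direction, each second derivative paired with its
      own frequency, so that the one-dimensional identity applies to each half.\<close>
    define G1 where "G1 x y = (Vxx x y + k\<^sup>2 * W t (x, y)) * sin (k * x) * sin (l * y)" for x y
    define G2 where "G2 x y = (Vyy x y + l\<^sup>2 * W t (x, y)) * sin (l * y) * sin (k * x)" for x y
    have ABc: "continuous_on ?R (\<lambda>p. (A t (fst p), B t (snd p)))"
      unfolding A_def B_def by (intro continuous_intros)
    have ABI: "(\<lambda>p. (A t (fst p), B t (snd p))) ` ?R \<subseteq> ?I"
      using inI by fastforce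
    have Wtc: "continuous_on ?R (W t)"
      unfolding W_def
      by (rule continuous_on_compose2[OF _ ABc ABI]) (use Vc in \<open>auto intro: continuous_on_subset\<close>)
    have Vxxc: "continuous_on ?R (\<lambda>p. Vxx (fst p) (snd p))" "continuous_on ?R (\<lambda>p. Vyy (fst p) (snd p))"
      unfolding Vxx_def Vyy_def using C1(2,3)
      by (auto simp: C1_on_def intro!: continuous_intros continuous_on_compose2[OF _ ABc ABI])
    have Gc: "continuous_on (cbox (0, 0) (a, b)) (\<lambda>(x, y). G1 x y)"
      "continuous_on (cbox (0, 0) (a, b)) (\<lambda>(x, y). G2 x y)"
      unfolding G1_def G2_def case_prod_unfold rectangle_eq_cbox[symmetric] prod.collapse
      by (intro continuous_intros Vxxc Wtc)+
    have G1: "integral (cbox (0, 0) (a, b)) (\<lambda>(x, y). G1 x y) =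
      integral (cbox 0 b) (\<lambda>y. k * (W t (0, y) - (-1) ^ m * W t (a, y)) * sin (l * y))"
    proof -
      have "integral (cbox (0, 0) (a, b)) (\<lambda>(x, y). G1 x y) = integral (cbox 0 b) (\<lambda>y. integral (cbox 0 a) (\<lambda>x. G1 x y))"
        using integral_prod_continuous[OF Gc(1)] integral_swap_continuous[OF Gc(1)] by simp
      also have "\<dots> = integral (cbox 0 b) (\<lambda>y. k * (W t (0, y) - (-1) ^ m * W t (a, y)) * sin (l * y))"
      proof (rule integral_cong)
        fix y assume "y \<in> cbox 0 b"
        then have y: "y \<in> {0..b}" by simp
        have "((\<lambda>x. (Vxx x y + k\<^sup>2 * W t (x, y)) * sin (k * x)) has_integral
            k * (W t (0, y) - (-1) ^ m * W t (a, y))) {0..a}"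
          unfolding k_def
        proof (rule integral_second_derivative_sine[OF ab(1)])
          fix x assume x: "x \<in> {0..a}"
          show "((\<lambda>x. W t (x, y)) has_real_derivative t * partial_x V (A t x, B t y)) (at x)"
            using DERIV_chain2[OF C1_onD(1)[OF C1(1) inI[OF x y]] dA] by (simp add: W_def mult.commute)
          show "((\<lambda>x. t * partial_x V (A t x, B t y)) has_real_derivative Vxx x y) (at x)"
            using DERIV_cmult[OF DERIV_chain2[OF C1_onD(1)[OF C1(2) inI[OF x y]] dA], of t]
            by (simp add: Vxx_def power2_eq_square mult_ac)
        qed
        from has_integral_mult_left[OF this, of "sin (l * y)"]
        show "integral (cbox 0 a) (\<lambda>x. G1 x y) = k * (W t (0, y) - (-1) ^ m * W t (a, y)) * sin (l * y)"
          unfolding G1_def cbox_interval by (rule integral_unique)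
      qed
      finally show ?thesis .
    qed
    have G2: "integral (cbox (0, 0) (a, b)) (\<lambda>(x, y). G2 x y) =
      integral (cbox 0 a) (\<lambda>x. l * (W t (x, 0) - (-1) ^ n * W t (x, b)) * sin (k * x))"
    proof -
      have "integral (cbox (0, 0) (a, b)) (\<lambda>(x, y). G2 x y) = integral (cbox 0 a) (\<lambda>x. integral (cbox 0 b) (\<lambda>y. G2 x y))"
        using integral_prod_continuous[OF Gc(2)] by simp
      also have "\<dots> = integral (cbox 0 a) (\<lambda>x. l * (W t (x, 0) - (-1) ^ n * W t (x, b)) * sin (k * x))"
      proof (rule integral_cong)
        fix x assume "x \<in> cbox 0 a"
        then have x: "x \<in> {0..a}" by simp
        have "((\<lambda>y. (Vyy x y + l\<^sup>2 * W t (x, y)) * sin (l * y)) has_integral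
            l * (W t (x, 0) - (-1) ^ n * W t (x, b))) {0..b}"
          unfolding l_def
        proof (rule integral_second_derivative_sine[OF ab(2)])
          fix y assume y: "y \<in> {0..b}"
          show "((\<lambda>y. W t (x, y)) has_real_derivative t * partial_y V (A t x, B t y)) (at y)"
            using DERIV_chain2[OF C1_onD(2)[OF C1(1) inI[OF x y]] dB] by (simp add: W_def mult.commute)
          show "((\<lambda>y. t * partial_y V (A t x, B t y)) has_real_derivative Vyy x y) (at y)"
            using DERIV_cmult[OF DERIV_chain2[OF C1_onD(2)[OF C1(3) inI[OF x y]] dB], of t]
            by (simp add: Vyy_def power2_eq_square mult_ac)
        qed
        from has_integral_mult_left[OF this, of "sin (k * x)"]
        show "integral (cbox 0 b) (\<lambda>y. G2 x y) = l * (W t (x, 0) - (-1) ^ n * W t (x, b)) * sin (k * x)"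
          unfolding G2_def cbox_interval by (rule integral_unique)
      qed
      finally show ?thesis .
    qed
    have "(k\<^sup>2 + l\<^sup>2 - \<mu> * t\<^sup>2) * integral (cbox (0, 0) (a, b)) (\<lambda>p. W t p * sine_mode a b (m, n) p) =
        integral (cbox (0, 0) (a, b)) (\<lambda>p. (k\<^sup>2 + l\<^sup>2 - \<mu> * t\<^sup>2) * (W t p * sine_mode a b (m, n) p))"
      by (rule integral_mult_right[symmetric])
    also have "\<dots> = integral (cbox (0, 0) (a, b)) (\<lambda>p. (\<lambda>(x, y). G1 x y) p + (\<lambda>(x, y). G2 x y) p)"
    proof (rule integral_cong)
      fix p assume "p \<in> cbox (0, 0) (a, b)"
      then obtain x y where p: "p = (x, y)" "x \<in> {0..a}" "y \<in> {0..b}"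
        by (auto simp: rectangle_eq_cbox[symmetric])
      have "Vxx x y + Vyy x y = - t\<^sup>2 * \<mu> * W t (x, y)"
      proof -
        have "Vxx x y + Vyy x y = t\<^sup>2 * laplacian V (A t x, B t y)"
          by (simp add: Vxx_def Vyy_def laplacian_def distrib_left)
        also have "laplacian V (A t x, B t y) = - (\<mu> * W t (x, y))"
          using eq[OF inI[OF p(2,3)]] by (simp add: W_def)
        finally show ?thesis by simp
      qed
      then have "(k\<^sup>2 + l\<^sup>2 - \<mu> * t\<^sup>2) * W t (x, y) = (Vxx x y + k\<^sup>2 * W t (x, y)) + (Vyy x y + l\<^sup>2 * W t (x, y))"
        by (simp add: algebra_simps)
      then have "(k\<^sup>2 + l\<^sup>2 - \<mu> * t\<^sup>2) * W t (x, y) * (sin (k * x) * sin (l * y)) = G1 x y + G2 x y"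
        by (simp add: G1_def G2_def distrib_right)
      then show "(k\<^sup>2 + l\<^sup>2 - \<mu> * t\<^sup>2) * (W t p * sine_mode a b (m, n) p) = (\<lambda>(x, y). G1 x y) p + (\<lambda>(x, y). G2 x y) p"
        by (simp add: p sine_mode_def k_def l_def mult_ac)
    qed
    also have "\<dots> = integral (cbox (0, 0) (a, b)) (\<lambda>(x, y). G1 x y) + integral (cbox (0, 0) (a, b)) (\<lambda>(x, y). G2 x y)"
      by (intro integral_add integrable_continuous Gc)
    finally show ?thesis unfolding \<Phi>_def G1 G2 by simp
  qed
  \<comment> \<open>No derivative of \<open>V\<close> is left in \<open>\<Phi>\<close>, so
    continuity of \<open>V\<close> on the closed rectangle suffices for the limit
    \<open>t = 1\<close>.\<close>
  moreover have "continuous_on {0..1} \<Phi>"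
    unfolding \<Phi>_def
  proof (intro continuous_intros integral_continuous_on_param)
    have *: "continuous_on S (\<lambda>z. W (f z) (g z))"
      if "continuous_on S f" "continuous_on S g" "\<And>z. z \<in> S \<Longrightarrow> f z \<in> {0..1} \<and> g z \<in> ?R"
      for f g and S :: "(real \<times> 'c::topological_space) set"
    proof -
      have "(\<lambda>z. (f z, g z)) ` S \<subseteq> {0..1} \<times> ?R"
        by (rule image_subsetI, rule SigmaI) (use that(3) in blast)+
      from continuous_on_compose2[OF Wc continuous_on_Pair[OF that(1,2)] this] show ?thesis by simp
    qed
    show "continuous_on ({0..1} \<times> cbox (0, 0) (a, b)) (\<lambda>(t, p). W t p * sine_mode a b (m, n) p)"
      unfolding case_prod_unfold
      by (intro continuous_intros * continuous_on_compose2[OF continuous_on_sine_mode[of UNIV]])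
        (auto simp: rectangle_eq_cbox)
    show "continuous_on ({0..1} \<times> cbox 0 b) (\<lambda>(t, y). k * (W t (0, y) - (-1) ^ m * W t (a, y)) * sin (l * y))"
      unfolding case_prod_unfold using ab by (intro continuous_intros *) auto
    show "continuous_on ({0..1} \<times> cbox 0 a) (\<lambda>(t, x). l * (W t (x, 0) - (-1) ^ n * W t (x, b)) * sin (k * x))"
      unfolding case_prod_unfold using ab by (intro continuous_intros *) auto
  qed
  ultimately have "\<Phi> 1 = 0"
    using continuous_constant_on_closure[of "{0<..<1}" \<Phi> 0 1] by simp
  moreover have W1: "W 1 p = V p" for p by (simp add: W_def A_def B_def)
  \<comment> \<open>At \<open>t = 1\<close> the boundary terms involve \<open>V\<close> on the edges
    only, where the Dirichlet condition makes it 0.\<close>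
  moreover have "integral (cbox 0 b) (\<lambda>y. k * (W 1 (0, y) - (-1) ^ m * W 1 (a, y)) * sin (l * y)) = integral (cbox 0 b) (\<lambda>y. 0)"
    using bd ab by (intro integral_cong) (simp add: W1)
  moreover have "integral (cbox 0 a) (\<lambda>x. l * (W 1 (x, 0) - (-1) ^ n * W 1 (x, b)) * sin (k * x)) = integral (cbox 0 a) (\<lambda>x. 0)"
    using bd ab by (intro integral_cong) (simp add: W1)
  ultimately have "(k\<^sup>2 + l\<^sup>2 - \<mu>) * integral (cbox (0, 0) (a, b)) (\<lambda>p. V p * sine_mode a b (m, n) p) = 0"
    by (simp add: \<Phi>_def)
  then show ?thesis using ne by (simp add: rectangle_eq_cbox k_def l_def)
qed

section \<open>Eigenspaces of the rectangle\<close>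

interpretation fun_space: vector_space "fun_scale :: real \<Rightarrow> ('a \<Rightarrow> real) \<Rightarrow> 'a \<Rightarrow> real"
  by (rule vector_space_fun_scale)

text \<open>Derivatives are local, so a formula valid only on the open set \<open>U\<close>
  determines them there. The conclusion returns formulas for the partial derivatives on
  \<open>U\<close>, ready for a second application.\<close>

lemma C1_onI:
  assumes U: "open U" and eq: "\<And>p. p \<in> U \<Longrightarrow> u p = w p"
    and x: "\<And>x y. (x, y) \<in> U \<Longrightarrow> ((\<lambda>s. w (s, y)) has_real_derivative wx (x, y)) (at x)"
    and y: "\<And>x y. (x, y) \<in> U \<Longrightarrow> ((\<lambda>t. w (x, t)) has_real_derivative wy (x, y)) (at y)"
    and cont: "continuous_on U wx" "continuous_on U wy"
  shows "C1_on U u \<and> (\<forall>p\<in>U. partial_x u p = wx p \<and> partial_y u p = wy p)"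
proof -
  have dx: "((\<lambda>s. u (s, y)) has_real_derivative wx (x, y)) (at x)" if p: "(x, y) \<in> U" for x y
  proof -
    have "\<forall>\<^sub>F s in nhds x. (s, y) \<in> U"
    proof -
      have "open ((\<lambda>s. (s, y)) -` U)"
        by (intro open_vimage U continuous_intros)
      then show ?thesis using p eventually_nhds_in_open by fastforce
    qed
    then have "\<forall>\<^sub>F s in nhds x. u (s, y) = w (s, y)"
      by eventually_elim (rule eq)
    from DERIV_cong_ev[OF refl this refl, THEN iffD2, OF x[OF p]] show ?thesis .
  qed
  have dy: "((\<lambda>t. u (x, t)) has_real_derivative wy (x, y)) (at y)" if p: "(x, y) \<in> U" for x y
  proof -
    have "\<forall>\<^sub>F t in nhds y. (x, t) \<in> U"
    proof -
      have "open ((\<lambda>t. (x, t)) -` U)"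
        by (intro open_vimage U continuous_intros)
      then show ?thesis using p eventually_nhds_in_open by fastforce
    qed
    then have "\<forall>\<^sub>F t in nhds y. u (x, t) = w (x, t)"
      by eventually_elim (rule eq)
    from DERIV_cong_ev[OF refl this refl, THEN iffD2, OF y[OF p]] show ?thesis .
  qed
  have px: "partial_x u p = wx p" if "p \<in> U" for p
    using dx[of "fst p" "snd p"] that by (simp add: partial_x_def case_prod_unfold DERIV_imp_deriv)
  have py: "partial_y u p = wy p" if "p \<in> U" for p
    using dy[of "fst p" "snd p"] that by (simp add: partial_y_def case_prod_unfold DERIV_imp_deriv)
  have "continuous_on U (partial_x u)" "continuous_on U (partial_y u)"
    by (rule continuous_on_eq[OF cont(1)], simp add: px) (rule continuous_on_eq[OF cont(2)], simp add: py)
  then have "C1_on U u"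
    unfolding C1_on_def real_differentiable_def using dx dy by blast
  with px py show ?thesis by blast
qed

text \<open>Elements of the eigenspace vanish outside the closed rectangle, hence the
  cut-off.\<close>

definition zero_extended_mode :: "real \<Rightarrow> real \<Rightarrow> nat \<times> nat \<Rightarrow> real \<times> real \<Rightarrow> real" where
  "zero_extended_mode a b i = (\<lambda>p. if p \<in> {0..a} \<times> {0..b} then sine_mode a b i p else 0)"

definition mode_eigenvalue :: "real \<Rightarrow> real \<Rightarrow> nat \<times> nat \<Rightarrow> real" where
  "mode_eigenvalue a b = (\<lambda>(m, n). (m * (pi / a))\<^sup>2 + (n * (pi / b))\<^sup>2)"

definition eigenmodes :: "real \<Rightarrow> real \<Rightarrow> real \<Rightarrow> (nat \<times> nat) set" where
  "eigenmodes a b \<mu> = {i. 0 < fst i \<and> 0 < snd i \<and> mode_eigenvalue a b i = \<mu>}"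

lemma zero_extended_mode_in_eigenspace:
  assumes ab: "a > 0" "b > 0"
  shows "zero_extended_mode a b i \<in> dirichlet_eigenspace ({0..a} \<times> {0..b}) (mode_eigenvalue a b i)"
proof -
  obtain m n where i: "i = (m, n)" by fastforce
  define k where "k = m * (pi / a)"
  define l where "l = n * (pi / b)"
  let ?R = "{0..a} \<times> {0..b}"
  let ?I = "{0<..<a} \<times> {0<..<b}"
  let ?V = "zero_extended_mode a b i"
  have cl: "closure ?R = ?R" by (simp add: closure_Times)
  have int: "interior ?R = ?I" by (simp add: interior_Times)
  have I: "open ?I" by (intro open_Times) auto
  have mode: "sine_mode a b i (x, y) = sin (k * x) * sin (l * y)" for x y
    by (simp add: sine_mode_def i k_def l_def)
  have V: "?V p = sin (k * fst p) * sin (l * snd p)" if "p \<in> ?R" for p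
    using that mode[of "fst p" "snd p"] by (simp add: zero_extended_mode_def)
  have IR: "p \<in> ?R" if "p \<in> ?I" for p using that by auto
  have V0: "C1_on ?I ?V \<and> (\<forall>p\<in>?I. partial_x ?V p = k * (cos (k * fst p) * sin (l * snd p)) \<and>
      partial_y ?V p = l * (sin (k * fst p) * cos (l * snd p)))"
    by (rule C1_onI[OF I V[OF IR]])
      (auto intro!: derivative_eq_intros continuous_intros)
  have Vx: "C1_on ?I (partial_x ?V) \<and>
      (\<forall>p\<in>?I. partial_x (partial_x ?V) p = - k\<^sup>2 * (sin (k * fst p) * sin (l * snd p)) \<and>
        partial_y (partial_x ?V) p = k * l * (cos (k * fst p) * cos (l * snd p)))"
    by (rule C1_onI[OF I, where w = "\<lambda>p. k * (cos (k * fst p) * sin (l * snd p))"])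
      (use V0 in \<open>auto intro!: derivative_eq_intros continuous_intros simp: power2_eq_square\<close>)
  have Vy: "C1_on ?I (partial_y ?V) \<and>
      (\<forall>p\<in>?I. partial_x (partial_y ?V) p = k * l * (cos (k * fst p) * cos (l * snd p)) \<and>
        partial_y (partial_y ?V) p = - l\<^sup>2 * (sin (k * fst p) * sin (l * snd p)))"
    by (rule C1_onI[OF I, where w = "\<lambda>p. l * (sin (k * fst p) * cos (l * snd p))"])
      (use V0 in \<open>auto intro!: derivative_eq_intros continuous_intros simp: power2_eq_square\<close>)
  have "continuous_on ?R ?V"
    using continuous_on_sine_mode[of ?R a b i]
    by (rule continuous_on_eq) (simp add: zero_extended_mode_def)
  moreover have "C2_on ?I ?V" using V0 Vx Vy by (simp add: C2_on_def)
  moreover have "- laplacian ?V p = mode_eigenvalue a b i * ?V p" if "p \<in> ?I" for p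
    using bspec[OF conjunct2[OF Vx] that] bspec[OF conjunct2[OF Vy] that] V[OF IR[OF that]]
    by (simp add: laplacian_def mode_eigenvalue_def i k_def l_def distrib_right)
  moreover have "?V p = 0" if "p \<in> ?R - ?I" for p
  proof -
    have "k * a = real m * pi" "l * b = real n * pi" using ab by (simp_all add: k_def l_def)
    then have "sin (k * a) = 0" "sin (l * b) = 0" by simp_all
    moreover have "fst p \<in> {0, a} \<or> snd p \<in> {0, b}" using that by (cases p) auto
    ultimately show ?thesis using V[of p] that by auto
  qed
  moreover have "?V p = 0" if "p \<notin> ?R" for p
    unfolding zero_extended_mode_def using that by (rule if_not_P)
  ultimately show ?thesis
    unfolding dirichlet_eigenspace_def cl int frontier_def by blast
qed

lemma finite_eigenmodes:
  assumes ab: "a > 0" "b > 0"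
  shows "finite (eigenmodes a b \<mu>)"
proof (rule finite_subset)
  have bound: "m \<le> nat \<lceil>\<mu> / (pi / c)\<^sup>2\<rceil>" if "(real m * (pi / c))\<^sup>2 \<le> \<mu>" "c > 0" for m c
  proof -
    have "real m \<le> (real m)\<^sup>2" by (cases m) (simp_all add: power2_eq_square)
    also have "\<dots> \<le> \<mu> / (pi / c)\<^sup>2"
      using that by (simp add: pos_le_divide_eq flip: power_mult_distrib)
    finally show ?thesis by linarith
  qed
  show "eigenmodes a b \<mu> \<subseteq> {..nat \<lceil>\<mu> / (pi / a)\<^sup>2\<rceil>} \<times> {..nat \<lceil>\<mu> / (pi / b)\<^sup>2\<rceil>}"
  proof
    fix i assume i: "i \<in> eigenmodes a b \<mu>"
    obtain m n where mn: "i = (m, n)" by fastforce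
    have "(m * (pi / a))\<^sup>2 + (n * (pi / b))\<^sup>2 = \<mu>"
      using i by (simp add: eigenmodes_def mode_eigenvalue_def mn)
    moreover have "(m * (pi / a))\<^sup>2 \<ge> 0" "(n * (pi / b))\<^sup>2 \<ge> 0" by simp_all
    ultimately have "(m * (pi / a))\<^sup>2 \<le> \<mu>" "(n * (pi / b))\<^sup>2 \<le> \<mu>" by linarith+
    then show "i \<in> {..nat \<lceil>\<mu> / (pi / a)\<^sup>2\<rceil>} \<times> {..nat \<lceil>\<mu> / (pi / b)\<^sup>2\<rceil>}"
      using bound ab by (simp add: mn)
  qed
qed simp

lemma sum_fun_apply: "(\<Sum>i\<in>A. f i) x = (\<Sum>i\<in>A. f i x)"
  by (induction A rule: infinite_finite_induct) auto

lemma integral_zero_extended_mode: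
  assumes ab: "a > 0" "b > 0" and "0 < fst i" "0 < snd i" "0 < fst j" "0 < snd j"
  shows "integral ({0..a} \<times> {0..b}) (\<lambda>p. zero_extended_mode a b i p * sine_mode a b j p) =
    (if i = j then a * b / 4 else 0)"
  unfolding integral_sine_mode_product[OF assms, symmetric]
  by (rule integral_cong) (simp add: zero_extended_mode_def)

lemma integrable_zero_extended_mode:
  "(\<lambda>p. c * zero_extended_mode a b i p * sine_mode a b j p) integrable_on {0..a} \<times> {0..b}"
proof -
  have "continuous_on (cbox (0, 0) (a, b)) (\<lambda>p. c * sine_mode a b i p * sine_mode a b j p)"
    by (intro continuous_intros continuous_on_sine_mode)
  then have "(\<lambda>p. c * sine_mode a b i p * sine_mode a b j p) integrable_on {0..a} \<times> {0..b}"
    unfolding rectangle_eq_cbox by (rule integrable_continuous)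
  then show ?thesis
    by (rule integrable_eq) (simp add: zero_extended_mode_def)
qed

text \<open>If two distinct indices gave the same function, its inner product with one of the two
  modes would be both \<open>a b / 4\<close> and 0. Thus counting indices counts functions.\<close>

lemma inj_on_zero_extended_mode:
  assumes ab: "a > 0" "b > 0"
  shows "inj_on (zero_extended_mode a b) (eigenmodes a b \<mu>)"
proof (rule inj_onI, rule ccontr)
  fix i j assume *: "i \<in> eigenmodes a b \<mu>" "j \<in> eigenmodes a b \<mu>"
    "zero_extended_mode a b i = zero_extended_mode a b j" "i \<noteq> j"
  have "a * b / 4 = 0"
    using integral_zero_extended_mode[OF ab, of i i] integral_zero_extended_mode[OF ab, of j i] *
    by (simp add: eigenmodes_def)
  then show False using ab by simp
qed

lemma independent_zero_extended_modes:
  assumes ab: "a > 0" "b > 0"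
  shows "fun_space.independent (zero_extended_mode a b ` eigenmodes a b \<mu>)"
proof (rule fun_space.independent_if_scalars_zero)
  let ?B = "zero_extended_mode a b ` eigenmodes a b \<mu>"
  let ?R = "{0..a} \<times> {0..b}"
  show fin: "finite ?B" using finite_eigenmodes[OF ab] by simp
  fix f x assume sum: "(\<Sum>x\<in>?B. fun_scale (f x) x) = 0" and x: "x \<in> ?B"
  obtain j where j: "j \<in> eigenmodes a b \<mu>" "x = zero_extended_mode a b j" using x by blast
  \<comment> \<open>Orthogonality: pairing the vanishing combination with the mode \<open>j\<close>
    isolates the coefficient of \<open>x\<close>.\<close>
  have "0 = integral ?R (\<lambda>p. (\<Sum>y\<in>?B. fun_scale (f y) y) p * sine_mode a b j p)"
    by (simp add: sum)
  also have "\<dots> = integral ?R (\<lambda>p. \<Sum>y\<in>?B. f y * y p * sine_mode a b j p)"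
    by (simp add: sum_fun_apply sum_distrib_right fun_scale_def)
  also have "\<dots> = (\<Sum>y\<in>?B. integral ?R (\<lambda>p. f y * y p * sine_mode a b j p))"
    by (rule integral_sum[OF fin])
      (elim imageE, simp only:, rule integrable_zero_extended_mode)
  also have "\<dots> = (\<Sum>y\<in>?B. if y = x then f y * (a * b / 4) else 0)"
  proof (rule sum.cong[OF refl])
    fix y assume "y \<in> ?B"
    then obtain i where i: "i \<in> eigenmodes a b \<mu>" "y = zero_extended_mode a b i" by blast
    have "y = x \<longleftrightarrow> i = j" using i j inj_on_zero_extended_mode[OF ab, of \<mu>] by (auto dest: inj_onD)
    moreover have "integral ?R (\<lambda>p. f y * y p * sine_mode a b j p) = f y * integral ?R (\<lambda>p. y p * sine_mode a b j p)"
      by (simp add: mult.assoc)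
    ultimately show "integral ?R (\<lambda>p. f y * y p * sine_mode a b j p) = (if y = x then f y * (a * b / 4) else 0)"
      using integral_zero_extended_mode[OF ab, of i j] i j by (simp add: eigenmodes_def)
  qed
  also have "\<dots> = f x * (a * b / 4)" using fin x by simp
  finally show "f x = 0" using ab by simp
qed

text \<open>\<open>U\<close> is the Fourier projection of \<open>V\<close> onto the finitely many
  modes with eigenvalue \<open>\<mu>\<close>. The difference \<open>V - U\<close> is orthogonal to
  these modes by the choice of coefficients and to all others by Green's identity, so completeness
  makes it vanish.\<close>

lemma eigenspace_subset_span_modes:
  assumes ab: "a > 0" "b > 0"
  shows "dirichlet_eigenspace ({0..a} \<times> {0..b}) \<mu> \<subseteq>
    fun_space.span (zero_extended_mode a b ` eigenmodes a b \<mu>)"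
proof
  let ?S = "eigenmodes a b \<mu>"
  let ?R = "{0..a} \<times> {0..b}"
  fix V assume V: "V \<in> dirichlet_eigenspace ?R \<mu>"
  have cl: "closure ?R = ?R" by (simp add: closure_Times)
  have Vc: "continuous_on ?R V" and out: "\<And>p. p \<notin> ?R \<Longrightarrow> V p = 0"
    using V unfolding dirichlet_eigenspace_def cl by blast+
  \<comment> \<open>The divisor \<open>a b / 4\<close> is the squared norm of a mode.\<close>
  define c where "c i = integral ?R (\<lambda>p. V p * sine_mode a b i p) / (a * b / 4)" for i
  define U where "U = (\<Sum>i\<in>?S. fun_scale (c i) (zero_extended_mode a b i))"
  have U: "U p = (\<Sum>i\<in>?S. c i * zero_extended_mode a b i p)" for p
    by (simp add: U_def sum_fun_apply fun_scale_def)
  have UR: "U p = (\<Sum>i\<in>?S. c i * sine_mode a b i p)" if "p \<in> ?R" for p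
    unfolding U using that by (simp add: zero_extended_mode_def)
  have "continuous_on ?R (\<lambda>p. \<Sum>i\<in>?S. c i * sine_mode a b i p)"
    by (intro continuous_intros continuous_on_sine_mode)
  then have Uc: "continuous_on ?R U" by (rule continuous_on_eq) (simp add: UR)
  have "V p - U p = 0" if "p \<in> ?R" for p
  proof (rule sine_modes_complete[OF ab _ _ that])
    show "continuous_on ?R (\<lambda>p. V p - U p)" by (intro continuous_intros Vc Uc)
    fix m n :: nat assume mn: "m > 0" "n > 0"
    define j where "j = (m, n)"
    have j: "fst j > 0" "snd j > 0" using mn by (simp_all add: j_def)
    have int: "(\<lambda>p. W p * sine_mode a b j p) integrable_on ?R" if "continuous_on ?R W" for W
      unfolding rectangle_eq_cbox
      by (intro integrable_continuous continuous_intros continuous_on_sine_mode)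
        (use that in \<open>simp add: rectangle_eq_cbox\<close>)
    have "integral ?R (\<lambda>p. U p * sine_mode a b j p) =
        integral ?R (\<lambda>p. \<Sum>i\<in>?S. c i * zero_extended_mode a b i p * sine_mode a b j p)"
      by (simp add: U sum_distrib_right)
    also have "\<dots> = (\<Sum>i\<in>?S. integral ?R (\<lambda>p. c i * zero_extended_mode a b i p * sine_mode a b j p))"
      by (rule integral_sum[OF finite_eigenmodes[OF ab] integrable_zero_extended_mode])
    also have "\<dots> = (\<Sum>i\<in>?S. if i = j then c i * (a * b / 4) else 0)"
    proof (rule sum.cong[OF refl])
      fix i assume i: "i \<in> ?S"
      have "integral ?R (\<lambda>p. c i * zero_extended_mode a b i p * sine_mode a b j p) =
          c i * integral ?R (\<lambda>p. zero_extended_mode a b i p * sine_mode a b j p)"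
        by (simp add: mult.assoc)
      then show "integral ?R (\<lambda>p. c i * zero_extended_mode a b i p * sine_mode a b j p) =
          (if i = j then c i * (a * b / 4) else 0)"
        using integral_zero_extended_mode[OF ab, of i j] i j by (simp add: eigenmodes_def)
    qed
    also have "\<dots> = (if j \<in> ?S then c j * (a * b / 4) else 0)"
      using finite_eigenmodes[OF ab] by simp
    also have "\<dots> = integral ?R (\<lambda>p. V p * sine_mode a b j p)"
    proof (cases "j \<in> ?S")
      case True
      then show ?thesis using ab by (simp add: c_def)
    next
      case False
      then have "(m * (pi / a))\<^sup>2 + (n * (pi / b))\<^sup>2 \<noteq> \<mu>"
        using mn by (simp add: eigenmodes_def mode_eigenvalue_def j_def)
      then show ?thesis using eigenfunction_orthogonal_sine_mode[OF ab V] False by (simp add: j_def)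
    qed
    finally have "integral ?R (\<lambda>p. V p * sine_mode a b j p) - integral ?R (\<lambda>p. U p * sine_mode a b j p) = 0"
      by simp
    then show "integral ?R (\<lambda>p. (V p - U p) * sine_mode a b (m, n) p) = 0"
      unfolding j_def[symmetric] left_diff_distrib
      by (simp add: integral_diff[OF int[OF Vc] int[OF Uc]])
  qed
  moreover have "V p - U p = 0" if "p \<notin> ?R" for p
  proof -
    have "zero_extended_mode a b i p = 0" for i
      unfolding zero_extended_mode_def using that by (rule if_not_P)
    then show ?thesis using out[OF that] by (simp add: U)
  qed
  ultimately have "V = U" by (intro ext) (metis eq_iff_diff_eq_0)
  also have "U \<in> fun_space.span (zero_extended_mode a b ` ?S)"
    unfolding U_def by (intro fun_space.span_sum fun_space.span_scale fun_space.span_base) auto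
  finally show "V \<in> fun_space.span (zero_extended_mode a b ` ?S)" .
qed

text \<open>The modes are independent, lie in the eigenspace and span it, so their number is its
  dimension.\<close>

lemma eigenvalue_multiplicity_rectangle:
  assumes ab: "a > 0" "b > 0"
  shows "eigenvalue_multiplicity ({0..a} \<times> {0..b}) \<mu> = card (eigenmodes a b \<mu>)"
  unfolding eigenvalue_multiplicity_def
proof (rule fun_space.dim_unique[OF _ eigenspace_subset_span_modes[OF ab] independent_zero_extended_modes[OF ab]])
  show "zero_extended_mode a b ` eigenmodes a b \<mu> \<subseteq> dirichlet_eigenspace ({0..a} \<times> {0..b}) \<mu>"
    using zero_extended_mode_in_eigenspace[OF ab] by (auto simp: eigenmodes_def)
  show "card (zero_extended_mode a b ` eigenmodes a b \<mu>) = card (eigenmodes a b \<mu>)"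
    by (rule card_image[OF inj_on_zero_extended_mode[OF ab]])
qed

lemma dirichlet_eigenvalue_rectangle_iff:
  assumes ab: "a > 0" "b > 0"
  shows "dirichlet_eigenvalue ({0..a} \<times> {0..b}) \<mu> \<longleftrightarrow> eigenmodes a b \<mu> \<noteq> {}"
proof
  assume "dirichlet_eigenvalue ({0..a} \<times> {0..b}) \<mu>"
  then obtain V p where "V \<in> dirichlet_eigenspace ({0..a} \<times> {0..b}) \<mu>" "V p \<noteq> 0"
    by (auto simp: dirichlet_eigenvalue_def)
  then show "eigenmodes a b \<mu> \<noteq> {}"
    \<comment> \<open>Without modes the span is that of the empty set, which contains only the zero
      function.\<close>
    using eigenspace_subset_span_modes[OF ab, of \<mu>] by auto
next
  assume "eigenmodes a b \<mu> \<noteq> {}"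
  then obtain i where i: "i \<in> eigenmodes a b \<mu>" by blast
  then have "zero_extended_mode a b i \<noteq> 0"
    using independent_zero_extended_modes[OF ab, of \<mu>] fun_space.dependent_zero by (metis image_eqI)
  then have "\<exists>p. zero_extended_mode a b i p \<noteq> 0" by (auto simp: fun_eq_iff)
  then show "dirichlet_eigenvalue ({0..a} \<times> {0..b}) \<mu>"
    unfolding dirichlet_eigenvalue_def
    using i zero_extended_mode_in_eigenspace[OF ab, of i] by (auto simp: eigenmodes_def)
qed

section \<open>Property (M) and the arithmetic of the side ratio\<close>

lemma property_M_rectangle_iff:
  assumes ab: "a > 0" "b > 0"
  shows "property_M ({0..a} \<times> {0..b}) \<longleftrightarrow> (\<forall>k>0. \<exists>\<mu>. card (eigenmodes a b \<mu>) = k)"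
proof -
  \<comment> \<open>Being an eigenvalue means having at least one mode, so this condition turns into
    positivity of the count.\<close>
  have eq: "{eigenvalue_multiplicity ({0..a} \<times> {0..b}) \<mu> |\<mu>. dirichlet_eigenvalue ({0..a} \<times> {0..b}) \<mu>} =
      {card (eigenmodes a b \<mu>) |\<mu>. card (eigenmodes a b \<mu>) > 0}"
    using finite_eigenmodes[OF ab]
    by (simp add: eigenvalue_multiplicity_rectangle[OF ab] dirichlet_eigenvalue_rectangle_iff[OF ab] card_gt_0_iff)
  show ?thesis
  proof
    assume M: "property_M ({0..a} \<times> {0..b})"
    show "\<forall>k>0. \<exists>\<mu>. card (eigenmodes a b \<mu>) = k"
    proof (intro allI impI)
      fix k :: nat assume "k > 0"
      then have "k \<in> {card (eigenmodes a b \<mu>) |\<mu>. card (eigenmodes a b \<mu>) > 0}"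
        using M unfolding property_M_def eq by simp
      then show "\<exists>\<mu>. card (eigenmodes a b \<mu>) = k" by blast
    qed
  next
    assume *: "\<forall>k>0. \<exists>\<mu>. card (eigenmodes a b \<mu>) = k"
    show "property_M ({0..a} \<times> {0..b})"
      unfolding property_M_def eq
    proof (intro equalityI subsetI)
      fix k :: nat assume "k \<in> {1..}"
      then have "k > 0" by simp
      moreover from this obtain \<mu> where "card (eigenmodes a b \<mu>) = k" using * by blast
      ultimately show "k \<in> {card (eigenmodes a b \<mu>) |\<mu>. card (eigenmodes a b \<mu>) > 0}" by blast
    qed auto
  qed
qed

text \<open>Two modes with equal eigenvalues give a relation \<open>M / a^2 = N / b^2\<close> with
  integers \<open>M\<close> and \<open>N\<close>; an irrational \<open>(a / b)^2\<close> forces both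
  to be 0.\<close>

lemma card_eigenmodes_le_1:
  assumes ab: "a > 0" "b > 0" and irr: "(a / b)\<^sup>2 \<notin> \<rat>"
  shows "card (eigenmodes a b \<mu>) \<le> 1"
proof -
  have "i = j" if i: "i \<in> eigenmodes a b \<mu>" and j: "j \<in> eigenmodes a b \<mu>" for i j
  proof -
    obtain m n m' n' where ij: "i = (m, n)" "j = (m', n')" by fastforce
    define M where "M = (real m)\<^sup>2 - (real m')\<^sup>2"
    define N where "N = (real n')\<^sup>2 - (real n)\<^sup>2"
    have "(m * (pi / a))\<^sup>2 + (n * (pi / b))\<^sup>2 = (m' * (pi / a))\<^sup>2 + (n' * (pi / b))\<^sup>2"
      using i j by (simp add: eigenmodes_def mode_eigenvalue_def ij)
    then have "pi\<^sup>2 * (M / a\<^sup>2) = pi\<^sup>2 * (N / b\<^sup>2)"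
      by (simp add: M_def N_def power_mult_distrib power_divide algebra_simps diff_divide_distrib)
    then have MN: "M = N * (a / b)\<^sup>2" using ab by (simp add: field_simps power_divide)
    have "N = 0"
    proof (rule ccontr)
      assume "N \<noteq> 0"
      then have "(a / b)\<^sup>2 = M / N" using MN by (simp add: field_simps)
      moreover have "M / N \<in> \<rat>" unfolding M_def N_def by (intro Rats_divide Rats_diff Rats_power Rats_of_nat)
      ultimately show False using irr by simp
    qed
    then have "M = 0" using MN by simp
    with \<open>N = 0\<close> show "i = j" by (simp add: M_def N_def ij)
  qed
  then show ?thesis using card_le_Suc0_iff_eq[OF finite_eigenmodes[OF ab]] by simp
qed

lemma ex_eigenmodes_eq_representations:
  fixes p q :: nat
  assumes ab: "a > 0" "b > 0" and pq: "0 < p" "0 < q" "(a / b)\<^sup>2 = p / q"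
  shows "\<exists>\<mu>. eigenmodes a b \<mu> = representations q p N"
proof -
  \<comment> \<open>Substituting \<open>b^2 = a^2 q / p\<close> makes every mode eigenvalue the
    multiple \<open>pi^2 / (q a^2)\<close> of \<open>q m^2 + p n^2\<close>.\<close>
  define \<mu> where "\<mu> = pi\<^sup>2 / (q * a\<^sup>2) * N"
  have b2: "b\<^sup>2 = a\<^sup>2 * q / p" using pq ab by (simp add: field_simps power_divide)
  have "mode_eigenvalue a b (m, n) = pi\<^sup>2 / (q * a\<^sup>2) * real (q * m\<^sup>2 + p * n\<^sup>2)" for m n
    using ab pq by (simp add: mode_eigenvalue_def power_mult_distrib power_divide b2 field_simps)
  then have "mode_eigenvalue a b (m, n) = \<mu> \<longleftrightarrow> q * m\<^sup>2 + p * n\<^sup>2 = N" for m n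
    unfolding \<mu>_def using ab pq by (simp del: of_nat_add of_nat_mult)
  then have "eigenmodes a b \<mu> = representations q p N"
    by (auto simp: eigenmodes_def representations_def)
  then show ?thesis ..
qed

theorem theorem1p1:
  fixes a b :: real
  assumes "a > 0" and "b > 0"
  shows "property_M ({0..a} \<times> {0..b}) \<longleftrightarrow> (a / b)\<^sup>2 \<in> \<rat>"
proof
  assume "property_M ({0..a} \<times> {0..b})"
  \<comment> \<open>A single eigenvalue of multiplicity 2 already rules out an irrational
    ratio.\<close>
  then obtain \<mu> where "card (eigenmodes a b \<mu>) = 2"
    using property_M_rectangle_iff[OF assms] zero_less_numeral by blast
  then show "(a / b)\<^sup>2 \<in> \<rat>" using card_eigenmodes_le_1[OF assms, of \<mu>] by fastforce
next
  assume "(a / b)\<^sup>2 \<in> \<rat>"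
  then obtain p q :: nat where pq: "q \<noteq> 0" "\<bar>(a / b)\<^sup>2\<bar> = p / q"
    by (rule Rats_abs_nat_div_natE)
  then have "(a / b)\<^sup>2 = p / q" by simp
  moreover from this have "0 < p" using assms by (cases p) auto
  ultimately show "property_M ({0..a} \<times> {0..b})"
    using property_M_rectangle_iff[OF assms] pq(1)
      ex_eigenmodes_eq_representations[OF assms, of p q] all_representation_numbers_occur[of p q]
    by (metis gr0I)
qed

end
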